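(* Let $q\ge0$ and $\xi=-\zeta$, where $\zeta$ is a subordinator with drift $c\ge0$ and Lévy measure $\Pi$ such that, when $q=0$, there is some $\alpha\ge0$ for which $$\lim_{x\to\infty}\frac{\overline{\Pi}(x+y)}{\overline{\Pi}(x)}=e^{-\alpha y}\qquad\text{for all }y\in\mathbb{R}.$$ Let $k$ be the density of the exponential functional $I_{\mathbf{e}_q}=\int_0^{\mathbf{e}_q}e^{-\zeta_s}\,\mathrm{d}s$, where $\mathbf{e}_q$ is an exponential random variable of parameter $q$ independent of $\zeta$ ($\mathbf{e}_0=\infty$), and write $I=I_{\mathbf{e}_0}=\int_0^\infty e^{-\zeta_s}\,\mathrm{d}s$ when $q=0$. Then: (i) If $q>0$, then $k(x)\to q$ as $x\downarrow0$. (ii) If $q=0$, then $\mathbb{E}[I^{-\alpha}]<\infty$ and $$k(x)\sim\mathbb{E}\big[I^{-\alpha}\big]\,\overline{\Pi}(\log(1/x))\qquad\text{as }x\downarrow0.$$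
   Context: A subordinator $\zeta$ is a Lévy process, issued from $0$, with non-decreasing paths; $-\log\mathbb{E}[e^{-\lambda\zeta_1}]=c\lambda+\int_{(0,\infty)}(1-e^{-\lambda x})\,\Pi(\mathrm{d}x)$ for $\lambda\ge0$, where $\int_{(0,\infty)}(1\wedge x)\Pi(\mathrm{d}x)<\infty$. Notation: $\overline{\Pi}(x)=\Pi(x,\infty)$ for $x>0$; $1/c=\infty$ if $c=0$; $f(x)\sim g(x)$ means $f(x)/g(x)\to1$. The density $k$ of $I_{\mathbf{e}_q}$ is the version, zero outside $(0,1/c)$, which satisfies $$(1-cx)k(x)=\int_x^\infty\overline{\Pi}(\log(y/x))\,k(y)\,\mathrm{d}y+q\int_x^\infty k(y)\,\mathrm{d}y,\qquad x\in(0,1/c).$$ *)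

theory Defs
  imports "HOL-Probability.Probability"
begin

text \<open>
  A process is a family of random variables \<open>X t\<close> indexed by real times; only times \<open>t \<ge> 0\<close> matter.
  Path properties are required almost surely.
\<close>

definition levy_process :: "'a measure \<Rightarrow> (real \<Rightarrow> 'a \<Rightarrow> real) \<Rightarrow> bool" where
  "levy_process M X \<longleftrightarrow>
     prob_space M \<and>
     (\<forall>t\<ge>0. X t \<in> borel_measurable M) \<and>
     (AE \<omega> in M. X 0 \<omega> = 0) \<and>
     (\<forall>n (t :: nat \<Rightarrow> real). 0 \<le> t 0 \<and> mono t \<longrightarrow>
        prob_space.indep_vars M (\<lambda>_. borel) (\<lambda>i \<omega>. X (t (Suc i)) \<omega> - X (t i) \<omega>) {..<n}) \<and>
     (\<forall>s\<ge>0. \<forall>t\<ge>0. distr M borel (\<lambda>\<omega>. X (s + t) \<omega> - X s \<omega>) = distr M borel (X t)) \<and>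
     (AE \<omega> in M. (\<forall>t\<ge>0. continuous (at_right t) (\<lambda>s. X s \<omega>)) \<and>
                  (\<forall>t>0. \<exists>l. ((\<lambda>s. X s \<omega>) \<longlongrightarrow> l) (at_left t)))"

definition subordinator :: "'a measure \<Rightarrow> (real \<Rightarrow> 'a \<Rightarrow> real) \<Rightarrow> bool" where
  "subordinator M \<zeta> \<longleftrightarrow>
     levy_process M \<zeta> \<and> (AE \<omega> in M. mono_on {0..} (\<lambda>t. \<zeta> t \<omega>))"

text \<open>
  A measure on the open half-line is represented as a Borel measure on the reals that gives no mass
  to the complement.
\<close>

definition subordinator_levy_measure :: "real measure \<Rightarrow> bool" where
  "subordinator_levy_measure \<nu> \<longleftrightarrow>
     sets \<nu> = sets borel \<and> emeasure \<nu> {..0} = 0 \<and>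
     (\<integral>\<^sup>+ x \<in> {0<..}. ennreal (min 1 x) \<partial>\<nu>) < \<infinity>"

definition has_characteristics ::
    "'a measure \<Rightarrow> (real \<Rightarrow> 'a \<Rightarrow> real) \<Rightarrow> real \<Rightarrow> real measure \<Rightarrow> bool" where
  "has_characteristics M \<zeta> c \<nu> \<longleftrightarrow>
     0 \<le> c \<and> subordinator_levy_measure \<nu> \<and>
     (\<forall>l\<ge>0. - ln (prob_space.expectation M (\<lambda>\<omega>. exp (- l * \<zeta> 1 \<omega>))) =
        c * l + (LINT x:{0<..}|\<nu>. 1 - exp (- l * x)))"

text \<open>The tail of a Levy measure; it is finite, and only used, at positive arguments.\<close>

definition tail :: "real measure \<Rightarrow> real \<Rightarrow> real" where
  "tail \<nu> x = measure \<nu> {x<..}"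

text \<open>An exponential time of parameter \<open>0\<close> is identically infinite, hence the extended reals.\<close>

definition exponential_time :: "'a measure \<Rightarrow> real \<Rightarrow> ('a \<Rightarrow> ereal) \<Rightarrow> bool" where
  "exponential_time M q e \<longleftrightarrow>
     (if q = 0 then \<forall>\<omega>\<in>space M. e \<omega> = \<infinity>
      else \<exists>T. distributed M lborel T (exponential_density q) \<and> (\<forall>\<omega>\<in>space M. e \<omega> = ereal (T \<omega>)))"

definition indep_of_process :: "'a measure \<Rightarrow> ('a \<Rightarrow> ereal) \<Rightarrow> (real \<Rightarrow> 'a \<Rightarrow> real) \<Rightarrow> bool" where
  "indep_of_process M e X \<longleftrightarrow>
     prob_space.indep_set M
       {e -` B \<inter> space M |B. B \<in> sets borel}
       {(\<lambda>\<omega>. \<lambda>t\<in>{0..}. X t \<omega>) -` B \<inter> space M |B. B \<in> sets (Pi\<^sub>M {0..} (\<lambda>_. borel))}"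

text \<open>
  A divergent integral yields the value \<open>0\<close>.  This is harmless below: a convergent one is positive
  as soon as \<open>e \<omega> > 0\<close>, and a functional that has a density cannot take the value \<open>0\<close> with positive
  probability.
\<close>

definition exp_functional :: "(real \<Rightarrow> 'a \<Rightarrow> real) \<Rightarrow> ('a \<Rightarrow> ereal) \<Rightarrow> 'a \<Rightarrow> real" where
  "exp_functional \<zeta> e \<omega> = (LINT s:{s. 0 \<le> s \<and> ereal s < e \<omega>}|lborel. exp (- \<zeta> s \<omega>))"

text \<open>The interval \<open>(0, 1/c)\<close>, where \<open>1/c\<close> is infinite for \<open>c = 0\<close>.\<close>

definition density_range :: "real \<Rightarrow> real set" where
  "density_range c = {x. 0 < x \<and> (c = 0 \<or> x < 1 / c)}"

text \<open>
  The equation is stated with integrals valued in the extended nonnegative reals, so that it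
  includes the finiteness of its right-hand side. It determines the values of the density at every
  point, not only up to null sets.
\<close>

definition exp_functional_density ::
    "'a measure \<Rightarrow> (real \<Rightarrow> 'a \<Rightarrow> real) \<Rightarrow> ('a \<Rightarrow> ereal) \<Rightarrow> real \<Rightarrow> real measure \<Rightarrow> real \<Rightarrow>
      (real \<Rightarrow> real) \<Rightarrow> bool" where
  "exp_functional_density M \<zeta> e c \<nu> q k \<longleftrightarrow>
     k \<in> borel_measurable borel \<and> (\<forall>x. 0 \<le> k x) \<and>
     distributed M lborel (exp_functional \<zeta> e) (\<lambda>x. ennreal (k x)) \<and>
     (\<forall>x. x \<notin> density_range c \<longrightarrow> k x = 0) \<and>
     (\<forall>x\<in>density_range c.
        ennreal ((1 - c * x) * k x) =
          (\<integral>\<^sup>+ y \<in> {x<..}. ennreal (tail \<nu> (ln (y / x)) * k y) \<partial>lborel)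
          + ennreal q * (\<integral>\<^sup>+ y \<in> {x<..}. ennreal (k y) \<partial>lborel))"

end

theory Submission
  imports Defs "HOL-Real_Asymp.Real_Asymp"
begin

text \<open>
  The asymptotics follow from the integral equation by a contraction argument. Write
  \<open>K(x, y) = \<Pi>(log (y / x), \<infinity>)\<close> for \<open>0 < x < y\<close>, so that the equation reads
  \<open>(1 - c x) k(x) = \<integral> K(x, y) k(y) dy + q P(I > x)\<close>, and let \<open>J = \<integral> (1 - exp (- w)) \<Pi>(dw)\<close>, which is
  finite. By Tonelli, \<open>K\<close> has integral at most \<open>y J\<close> in \<open>x\<close>, and integral at most \<open>b J\<close> in
  \<open>y\<close> over \<open>(x, b)\<close>. Restricted to a short interval \<open>(0, b)\<close> the kernel is thus a contraction, both
  on \<open>L\<^sup>1\<close> and in the supremum norm.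

  The first difficulty is that \<open>k\<close> is a priori only integrable, while \<open>K\<close> may blow up on the
  diagonal. The weighted function \<open>w(x) = (b - x) k(x)\<close> satisfies an inequality of the same shape with
  a bounded inhomogeneity, because \<open>(y - x) K(x, y) \<le> y J\<close>. The excess of \<open>w\<close> over a large constant
  is therefore an integrable subsolution of the homogeneous equation, and the contraction on
  \<open>L\<^sup>1\<close> forces it to vanish (\<open>density_bound_weighted\<close>). Hence \<open>k\<close> is bounded near \<open>0\<close>; the jump term
  then tends to \<open>0\<close>, and \<open>P(I > x)\<close> to \<open>1\<close>, so \<open>k(x)\<close> tends to \<open>q\<close> (\<open>density_tendsto_rate\<close>).

  Now let \<open>q = 0\<close> and \<open>L(x) = \<Pi>(log (1 / x), \<infinity>)\<close>. The hypothesis says that \<open>L\<close> is regularly varying of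
  index \<open>\<alpha>\<close> at \<open>0\<close>, and that \<open>K(x, y) / L(x) = L(x / y) / L(x)\<close> tends to \<open>y\<close> to the power \<open>- \<alpha>\<close>.
  Dividing the equation by \<open>L(x)\<close> gives the claim, provided that the limit and the integral can be
  interchanged. For this, Potter's bounds on ratios of values of \<open>L\<close> show that \<open>K(x, y) L(y) / L(x)\<close>
  has a small integral over \<open>(x, d)\<close> when \<open>d\<close> and \<open>x / d\<close> are small; a contraction argument for \<open>k / L\<close> then yields
  \<open>k \<le> R L\<close> near \<open>0\<close> (\<open>density_le_L\<close>). With this the same bounds provide an integrable
  majorant, up to a part near the diagonal that is \<open>O(x)\<close>. Dominated convergence gives
  the finiteness of the moment and the limit at once (\<open>density_regular\<close>).
\<close>

section \<open>The jump kernel of a subordinator\<close>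

lemma emeasure_tail_finite:
  assumes "subordinator_levy_measure \<nu>" "0 < t"
  shows "emeasure \<nu> {t<..} < \<infinity>"
proof -
  have s [measurable_cong]: "sets \<nu> = sets borel" and
    f: "(\<integral>\<^sup>+ x \<in> {0<..}. ennreal (min 1 x) \<partial>\<nu>) < \<infinity>"
    using assms unfolding subordinator_levy_measure_def by auto
  have "ennreal (min 1 t) * emeasure \<nu> {t<..} = (\<integral>\<^sup>+ x. ennreal (min 1 t) * indicator {t<..} x \<partial>\<nu>)"
    by (simp add: nn_integral_cmult_indicator s)
  also have "\<dots> \<le> (\<integral>\<^sup>+ x \<in> {0<..}. ennreal (min 1 x) \<partial>\<nu>)"
    using assms(2) by (intro nn_integral_mono) (auto split: split_indicator intro!: ennreal_leI)
  finally have "ennreal (min 1 t) * emeasure \<nu> {t<..} < \<infinity>"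
    using f by (rule le_less_trans)
  then show ?thesis
    using assms(2) by (auto simp: ennreal_mult_less_top)
qed

lemma sigma_finite_levy_measure:
  assumes "subordinator_levy_measure \<nu>"
  shows "sigma_finite_measure \<nu>"
proof
  have s: "sets \<nu> = sets borel" and z: "emeasure \<nu> {..0} = 0"
    using assms unfolding subordinator_levy_measure_def by auto
  have sp: "space \<nu> = UNIV"
    using sets_eq_imp_space_eq[OF s] by simp
  have "\<exists>n. 1 / real (Suc n) < x" if "0 < x" for x :: real
    using reals_Archimedean[OF that] by (auto simp: inverse_eq_divide)
  then have "\<Union> (insert {..0} (range (\<lambda>n. {1 / real (Suc n) <..}))) = (UNIV :: real set)"
    by (auto simp: not_le simp del: of_nat_Suc) (meson not_le)
  then show "\<exists>A. countable A \<and> A \<subseteq> sets \<nu> \<and> \<Union> A = space \<nu> \<and> (\<forall>a\<in>A. emeasure \<nu> a \<noteq> \<infinity>)"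
    using z emeasure_tail_finite[OF assms] sp
    by (intro exI[of _ "insert {..0} (range (\<lambda>n. {1 / real (Suc n) <..}))"])
      (auto simp: s less_top[symmetric] simp del: of_nat_Suc)
qed

text \<open>
  The value at \<open>1\<close> of the Laplace exponent of the driftless subordinator with this Levy measure.
\<close>

definition jump_exponent :: "real measure \<Rightarrow> real" where
  "jump_exponent \<nu> = enn2real (\<integral>\<^sup>+ w \<in> {0<..}. ennreal (1 - exp (- w)) \<partial>\<nu>)"

lemma jump_exponent_nonneg [simp]: "0 \<le> jump_exponent \<nu>"
  by (simp add: jump_exponent_def)

lemma ennreal_jump_exponent:
  assumes "subordinator_levy_measure \<nu>"
  shows "ennreal (jump_exponent \<nu>) = (\<integral>\<^sup>+ w \<in> {0<..}. ennreal (1 - exp (- w)) \<partial>\<nu>)"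
proof -
  have "1 - exp (- w) \<le> min 1 w" for w :: real
    using exp_ge_add_one_self[of "- w"] by auto
  then have "(\<integral>\<^sup>+ w \<in> {0<..}. ennreal (1 - exp (- w)) \<partial>\<nu>) \<le> (\<integral>\<^sup>+ x \<in> {0<..}. ennreal (min 1 x) \<partial>\<nu>)"
    by (intro nn_integral_mono) (auto split: split_indicator intro!: ennreal_leI)
  also have "\<dots> < \<infinity>"
    using assms unfolding subordinator_levy_measure_def by auto
  finally show ?thesis
    by (simp add: jump_exponent_def)
qed

text \<open>
  Extending the kernel by \<open>0\<close> to \<open>y \<le> x\<close> turns integrals over the half-line above \<open>x\<close> into integrals
  over the reals, to which Tonelli's theorem applies directly.
\<close>

definition jump_kernel :: "real measure \<Rightarrow> real \<Rightarrow> real \<Rightarrow> real" where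
  "jump_kernel \<nu> x y = (if 0 < x \<and> x < y then tail \<nu> (ln (y / x)) else 0)"

lemma tail_nonneg [simp]: "0 \<le> tail \<nu> t"
  by (simp add: tail_def)

lemma jump_kernel_nonneg [simp]: "0 \<le> jump_kernel \<nu> x y"
  by (simp add: jump_kernel_def)

lemma ennreal_tail:
  assumes "subordinator_levy_measure \<nu>" "0 < t"
  shows "ennreal (tail \<nu> t) = emeasure \<nu> {t<..}"
  using emeasure_tail_finite[OF assms]
  by (simp add: tail_def emeasure_eq_ennreal_measure less_top)

lemma tail_antimono:
  assumes "subordinator_levy_measure \<nu>" "0 < s" "s \<le> t"
  shows "tail \<nu> t \<le> tail \<nu> s"
proof -
  have "sets \<nu> = sets borel"
    using assms unfolding subordinator_levy_measure_def by auto
  then have "emeasure \<nu> {t<..} \<le> emeasure \<nu> {s<..}"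
    using assms by (intro emeasure_mono) auto
  then show ?thesis
    using assms by (simp flip: ennreal_tail)
qed

text \<open>
  The tail is itself an integral over the jump sizes \<open>w\<close>. This form makes the kernel jointly
  measurable and lets its integrals be computed by exchanging \<open>w\<close> with \<open>x\<close> or \<open>y\<close>.
\<close>

lemma ennreal_jump_kernel:
  assumes "subordinator_levy_measure \<nu>"
  shows "ennreal (jump_kernel \<nu> x y) = 
    (\<integral>\<^sup>+ w. indicator {w. 0 < x \<and> x < y \<and> y < x * exp w} w \<partial>\<nu>)"
proof (cases "0 < x \<and> x < y")
  case True
  have s: "sets \<nu> = sets borel"
    using assms unfolding subordinator_levy_measure_def by auto
  have "ln (y / x) < w \<longleftrightarrow> y < x * exp w" for w
  proof -
    have "ln (y / x) < w \<longleftrightarrow> y / x < exp w"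
      using True by (subst exp_less_cancel_iff[symmetric], subst exp_ln) auto
    then show ?thesis using True by (simp add: field_simps)
  qed
  then have "(\<integral>\<^sup>+ w. indicator {w. 0 < x \<and> x < y \<and> y < x * exp w} w \<partial>\<nu>)
    = (\<integral>\<^sup>+ w. indicator {ln (y / x) <..} w \<partial>\<nu>)"
    using True by (intro nn_integral_cong) (auto split: split_indicator)
  also have "\<dots> = emeasure \<nu> {ln (y / x) <..}"
    by (simp add: s)
  finally show ?thesis
    using True ennreal_tail[OF assms, of "ln (y / x)"] by (simp add: jump_kernel_def)
qed (auto simp: jump_kernel_def)

lemma measurable_jump_kernel [measurable]:
  assumes "subordinator_levy_measure \<nu>"
  shows "(\<lambda>(x, y). jump_kernel \<nu> x y) \<in> borel_measurable (borel \<Otimes>\<^sub>M borel)"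
proof -
  interpret sigma_finite_measure \<nu> by (rule sigma_finite_levy_measure) fact
  have s [measurable_cong]: "sets \<nu> = sets borel"
    using assms unfolding subordinator_levy_measure_def by auto
  have [measurable]: "Measurable.pred (borel \<Otimes>\<^sub>M borel \<Otimes>\<^sub>M borel)
     (\<lambda>z::real\<times>real\<times>real. 0 < fst z \<and> fst z < fst (snd z) \<and> fst (snd z) < fst z * exp (snd (snd z)))"
    by measurable
  have "(\<lambda>z. ennreal (jump_kernel \<nu> (fst z) (snd z))) \<in> borel_measurable (borel \<Otimes>\<^sub>M borel)"
    unfolding ennreal_jump_kernel[OF assms] indicator_def by simp
  then have "(\<lambda>z. enn2real (ennreal (jump_kernel \<nu> (fst z) (snd z)))) \<in> borel_measurable (borel \<Otimes>\<^sub>M borel)"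
    by measurable
  then show ?thesis
    by (simp add: case_prod_beta)
qed

text \<open>
  For a fixed jump \<open>w\<close>, the points \<open>x\<close> from which it leads beyond \<open>y\<close> fill the interval
  \<open>(y exp (- w), y)\<close>, of length \<open>y (1 - exp (- w))\<close>.
\<close>

lemma nn_integral_jump_kernel_left:
  assumes "subordinator_levy_measure \<nu>" "0 < y"
  shows "(\<integral>\<^sup>+ x. ennreal (jump_kernel \<nu> x y) \<partial>lborel) \<le> ennreal (y * jump_exponent \<nu>)"
proof -
  interpret sigma_finite_measure \<nu> by (rule sigma_finite_levy_measure) fact
  interpret pair_sigma_finite lborel \<nu> ..
  have s [measurable_cong]: "sets \<nu> = sets borel"
    using assms unfolding subordinator_levy_measure_def by auto
  have "(\<integral>\<^sup>+ x. ennreal (jump_kernel \<nu> x y) \<partial>lborel) =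
    (\<integral>\<^sup>+ w. (\<integral>\<^sup>+ x. indicator {w. 0 < x \<and> x < y \<and> y < x * exp w} w \<partial>lborel) \<partial>\<nu>)"
    unfolding ennreal_jump_kernel[OF assms(1)] indicator_def
    by (subst Fubini') auto
  also have "\<dots> \<le> (\<integral>\<^sup>+ w. ennreal y * (ennreal (1 - exp (- w)) * indicator {0<..} w) \<partial>\<nu>)"
  proof (intro nn_integral_mono)
    fix w :: real
    have "(\<integral>\<^sup>+ x. indicator {w. 0 < x \<and> x < y \<and> y < x * exp w} w \<partial>lborel)
      = (\<integral>\<^sup>+ x. indicator {y * exp (- w)<..<y} x \<partial>lborel)"
      using assms(2) by (intro nn_integral_cong)
        (auto split: split_indicator simp: exp_minus field_simps,
         metis assms(2) exp_gt_zero mult_pos_pos zero_less_mult_pos2 less_trans)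
    also have "\<dots> = (if y * exp (- w) \<le> y then ennreal (y - y * exp (- w)) else 0)"
      by (auto simp: emeasure_lborel_Ioo)
    also have "\<dots> = ennreal y * (ennreal (1 - exp (- w)) * indicator {0<..} w)"
      using assms(2) by (auto split: split_indicator simp flip: ennreal_mult' simp: algebra_simps)
    finally show "(\<integral>\<^sup>+ x. indicator {w. 0 < x \<and> x < y \<and> y < x * exp w} w \<partial>lborel)
      \<le> ennreal y * (ennreal (1 - exp (- w)) * indicator {0<..} w)" by simp
  qed
  also have "\<dots> = ennreal (y * jump_exponent \<nu>)"
    using assms(2) by (subst nn_integral_cmult)
      (auto simp: ennreal_mult' ennreal_jump_exponent[OF assms(1)])
  finally show ?thesis .
qed

text \<open>
  For a fixed jump \<open>w\<close>, the points \<open>y\<close> passed from \<open>x\<close> and below \<open>b\<close> fill the interval from \<open>x\<close> to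
  the minimum of \<open>b\<close> and \<open>x exp w\<close>, whose length is at most \<open>b (1 - exp (- w))\<close> whichever of the two is
  smaller.
\<close>

lemma nn_integral_jump_kernel_right:
  assumes "subordinator_levy_measure \<nu>" "0 < x"
  shows "(\<integral>\<^sup>+ y \<in> {..<b}. ennreal (jump_kernel \<nu> x y) \<partial>lborel) \<le> ennreal (b * jump_exponent \<nu>)"
proof (cases "x < b")
  case True
  interpret sigma_finite_measure \<nu> by (rule sigma_finite_levy_measure) fact
  interpret pair_sigma_finite lborel \<nu> ..
  have s [measurable_cong]: "sets \<nu> = sets borel"
    using assms unfolding subordinator_levy_measure_def by auto
  have "(\<integral>\<^sup>+ y \<in> {..<b}. ennreal (jump_kernel \<nu> x y) \<partial>lborel) =
    (\<integral>\<^sup>+ y. \<integral>\<^sup>+ w. indicator {w. 0 < x \<and> x < y \<and> y < x * exp w} w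
        * indicator {..<b} y \<partial>\<nu> \<partial>lborel)"
    unfolding ennreal_jump_kernel[OF assms(1)] indicator_def
    by (subst nn_integral_multc) auto
  also have "\<dots> = (\<integral>\<^sup>+ w. \<integral>\<^sup>+ y. indicator {w. 0 < x \<and> x < y \<and> y < x * exp w} w
        * indicator {..<b} y \<partial>lborel \<partial>\<nu>)"
    unfolding indicator_def by (subst Fubini') auto
  also have "\<dots> \<le> (\<integral>\<^sup>+ w. ennreal b * (ennreal (1 - exp (- w)) * indicator {0<..} w) \<partial>\<nu>)"
  proof (intro nn_integral_mono)
    fix w :: real
    have "(\<integral>\<^sup>+ y. indicator {w. 0 < x \<and> x < y \<and> y < x * exp w} w
        * indicator {..<b} y \<partial>lborel)
      = (\<integral>\<^sup>+ y. indicator {x<..<min b (x * exp w)} y \<partial>lborel)"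
      using assms(2) by (intro nn_integral_cong) (auto split: split_indicator)
    also have "\<dots> \<le> ennreal (b * (1 - exp (- w)) * indicator {0<..} w)"
    proof (cases "0 < w")
      case w: True
      have "min b (x * exp w) - x \<le> b * (1 - exp (- w))"
      proof (cases "b \<le> x * exp w")
        case True
        then have "b * exp (- w) \<le> x"
          by (simp add: exp_minus field_simps)
        then show ?thesis by (simp add: algebra_simps min_def)
      next
        case False
        have "x * exp w - x = (x * exp w) * (1 - exp (- w))"
          by (simp add: algebra_simps exp_minus)
        also have "\<dots> \<le> b * (1 - exp (- w))"
          using False w by (intro mult_right_mono) auto
        finally show ?thesis by simp
      qed
      then show ?thesis
        using w True assms(2) by (auto simp: emeasure_lborel_Ioo intro!: ennreal_leI)
    next
      case False
      then have "x * exp w \<le> x" using assms(2) by simp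
      then show ?thesis using False by simp
    qed
    also have "\<dots> = ennreal b * (ennreal (1 - exp (- w)) * indicator {0<..} w)"
      using assms(2) True by (auto split: split_indicator simp flip: ennreal_mult' simp: algebra_simps)
    finally show "(\<integral>\<^sup>+ y. indicator {w. 0 < x \<and> x < y \<and> y < x * exp w} w
        * indicator {..<b} y \<partial>lborel)
      \<le> ennreal b * (ennreal (1 - exp (- w)) * indicator {0<..} w)" .
  qed
  also have "\<dots> = ennreal (b * jump_exponent \<nu>)"
    using assms(2) True by (subst nn_integral_cmult)
      (auto simp: ennreal_mult' ennreal_jump_exponent[OF assms(1)])
  finally show ?thesis .
next
  case False
  then have "(\<integral>\<^sup>+ y \<in> {..<b}. ennreal (jump_kernel \<nu> x y) \<partial>lborel) = (\<integral>\<^sup>+ y. 0 \<partial>(lborel :: real measure))"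
    by (intro nn_integral_cong) (auto split: split_indicator simp: jump_kernel_def)
  then show ?thesis by simp
qed

lemma jump_kernel_mono_right:
  assumes "subordinator_levy_measure \<nu>" "x < y" "y \<le> z"
  shows "jump_kernel \<nu> x z \<le> jump_kernel \<nu> x y"
  using assms by (auto simp: jump_kernel_def divide_right_mono intro!: tail_antimono)

text \<open>
  The kernel decreases in \<open>y\<close>, so its value at \<open>y\<close> is at most its mean over \<open>(x, y)\<close>.
\<close>

lemma jump_kernel_bound:
  assumes "subordinator_levy_measure \<nu>" "0 < x" "x < y"
  shows "(y - x) * jump_kernel \<nu> x y \<le> y * jump_exponent \<nu>"
proof -
  have "ennreal ((y - x) * jump_kernel \<nu> x y) = (\<integral>\<^sup>+ z \<in> {x<..<y}. ennreal (jump_kernel \<nu> x y) \<partial>lborel)"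
    using assms by (simp add: nn_integral_cmult_indicator ennreal_mult' mult.commute)
  also have "\<dots> \<le> (\<integral>\<^sup>+ z \<in> {..<y}. ennreal (jump_kernel \<nu> x z) \<partial>lborel)"
    using assms by (intro nn_integral_mono)
      (auto split: split_indicator intro!: ennreal_leI jump_kernel_mono_right)
  also have "\<dots> \<le> ennreal (y * jump_exponent \<nu>)"
    by (rule nn_integral_jump_kernel_right) fact+
  finally show ?thesis
    using assms by (simp add: ennreal_le_iff)
qed

lemma tail_tendsto_0:
  assumes "subordinator_levy_measure \<nu>"
  shows "(tail \<nu> \<longlongrightarrow> 0) at_top"
proof (rule order_tendstoI)
  have s: "sets \<nu> = sets borel"
    using assms unfolding subordinator_levy_measure_def by auto
  have "\<exists>n. x \<le> real (Suc n)" for x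
    using real_nat_ceiling_ge[of x] by (intro exI[of _ "nat \<lceil>x\<rceil>"]) simp
  then have "(\<Inter>n. {real (Suc n)<..}) = {}"
    by (simp add: set_eq_iff not_less)
  moreover have "(\<lambda>n. measure \<nu> {real (Suc n)<..}) \<longlonglongrightarrow> measure \<nu> (\<Inter>n. {real (Suc n)<..})"
    using emeasure_tail_finite[OF assms]
    by (intro Lim_measure_decseq) (auto simp: s decseq_def less_top[symmetric] simp del: of_nat_Suc)
  ultimately have lim: "(\<lambda>n. tail \<nu> (real (Suc n))) \<longlonglongrightarrow> 0"
    by (simp add: tail_def)
  fix a :: real assume "0 < a"
  then obtain n where n: "tail \<nu> (real (Suc n)) < a"
    using order_tendstoD(2)[OF lim, of a] by (auto simp: eventually_sequentially)
  show "eventually (\<lambda>t. tail \<nu> t < a) at_top"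
    using eventually_ge_at_top[of "real (Suc n)"]
    by eventually_elim
      (metis assms n le_less_trans of_nat_0_less_iff tail_antimono zero_less_Suc)
qed (auto intro!: always_eventually intro: less_le_trans[OF _ tail_nonneg])

section \<open>Boundedness and the limit at zero of a density solving the equation\<close>

text \<open>
  The integral equation, written with the kernel, together with the properties of a probability
  density on the positive half-line.
\<close>

locale density_equation =
  fixes \<nu> :: "real measure" and c q :: real and k :: "real \<Rightarrow> real"
  assumes levy: "subordinator_levy_measure \<nu>"
    and drift_nonneg: "0 \<le> c" and rate_nonneg: "0 \<le> q"
    and measurable_density [measurable]: "k \<in> borel_measurable borel"
    and density_nonneg [simp]: "0 \<le> k x"
    and density_zero: "x \<le> 0 \<Longrightarrow> k x = 0"
    and density_total: "(\<integral>\<^sup>+ y. ennreal (k y) \<partial>lborel) = 1"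
    and equation: "0 < x \<Longrightarrow> c * x < 1 \<Longrightarrow> ennreal ((1 - c * x) * k x) =
      (\<integral>\<^sup>+ y. ennreal (jump_kernel \<nu> x y * k y) \<partial>lborel)
      + ennreal q * (\<integral>\<^sup>+ y \<in> {x<..}. ennreal (k y) \<partial>lborel)"
begin

lemma measurable_jump_kernel_right [measurable]:
  "jump_kernel \<nu> x \<in> borel_measurable borel"
  using measurable_compose_Pair1[OF _ measurable_jump_kernel[OF levy], of x] by simp

lemma measurable_jump_kernel_left [measurable]:
  "(\<lambda>x. jump_kernel \<nu> x y) \<in> borel_measurable borel"
  using measurable_compose[OF _ measurable_jump_kernel[OF levy], of "\<lambda>x. (x, y)" borel] by simp

lemma density_tail_le_1: "(\<integral>\<^sup>+ y \<in> {x<..}. ennreal (k y) \<partial>lborel) \<le> 1"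
  unfolding density_total[symmetric] by (intro nn_integral_mono) (auto split: split_indicator)

text \<open>
  Beyond \<open>b\<close> the kernel is at most its value at \<open>b\<close>, and \<open>k\<close> has total mass \<open>1\<close>; only the part of the
  jump integral near the diagonal needs further care.
\<close>

lemma jump_term_split:
  assumes "x < b"
  shows "(\<integral>\<^sup>+ y. ennreal (jump_kernel \<nu> x y * k y) \<partial>lborel) \<le>
    (\<integral>\<^sup>+ y \<in> {..<b}. ennreal (jump_kernel \<nu> x y * k y) \<partial>lborel) + ennreal (jump_kernel \<nu> x b)"
proof -
  have "(\<integral>\<^sup>+ y. ennreal (jump_kernel \<nu> x y * k y) \<partial>lborel) \<le>
    (\<integral>\<^sup>+ y. ennreal (jump_kernel \<nu> x y * k y) * indicator {..<b} y
      + ennreal (jump_kernel \<nu> x b) * ennreal (k y) \<partial>lborel)"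
    using jump_kernel_mono_right[OF levy assms]
    by (intro nn_integral_mono)
      (auto split: split_indicator simp flip: ennreal_mult intro!: ennreal_leI mult_right_mono)
  also have "\<dots> = (\<integral>\<^sup>+ y \<in> {..<b}. ennreal (jump_kernel \<nu> x y * k y) \<partial>lborel) + ennreal (jump_kernel \<nu> x b)"
    by (subst nn_integral_add) (auto simp: nn_integral_cmult density_total)
  finally show ?thesis .
qed

text \<open>
  Integrating the hypothesis over \<open>x\<close> and exchanging the integrals bounds the mass of \<open>v\<close> by
  \<open>2 b J\<close> times itself, hence by half of itself. As the mass is finite it vanishes, and the
  pointwise hypothesis turns \<open>v = 0\<close> almost everywhere into \<open>v = 0\<close> everywhere.
\<close>

lemma jump_kernel_volterra_zero:
  fixes v :: "real \<Rightarrow> real"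
  assumes "0 < b" and small: "b * jump_exponent \<nu> \<le> 1 / 4"
    and [measurable]: "v \<in> borel_measurable borel" and nonneg: "\<And>x. 0 \<le> v x"
    and supp: "\<And>x. x \<notin> {0<..<b} \<Longrightarrow> v x = 0"
    and fin: "(\<integral>\<^sup>+ x. ennreal (v x) \<partial>lborel) < \<infinity>"
    and sub: "\<And>x. x \<in> {0<..<b} \<Longrightarrow>
      ennreal (v x) \<le> 2 * (\<integral>\<^sup>+ y. ennreal (jump_kernel \<nu> x y * v y) \<partial>lborel)"
  shows "v x = 0"
proof -
  have [measurable]: "(\<lambda>z. jump_kernel \<nu> (fst z) (snd z)) \<in> borel_measurable (borel \<Otimes>\<^sub>M borel)"
    using measurable_jump_kernel[OF levy] by (simp add: case_prod_beta)
  have "(\<integral>\<^sup>+ x. ennreal (v x) \<partial>lborel) \<le>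
      (\<integral>\<^sup>+ x. 2 * (\<integral>\<^sup>+ y. ennreal (jump_kernel \<nu> x y * v y) \<partial>lborel) \<partial>lborel)"
    using sub supp by (intro nn_integral_mono) (metis ennreal_0 zero_le)
  also have "\<dots> = 2 * (\<integral>\<^sup>+ x. \<integral>\<^sup>+ y. ennreal (jump_kernel \<nu> x y * v y) \<partial>lborel \<partial>lborel)"
    by (intro nn_integral_cmult) measurable
  also have "(\<integral>\<^sup>+ x. \<integral>\<^sup>+ y. ennreal (jump_kernel \<nu> x y * v y) \<partial>lborel \<partial>lborel)
      = (\<integral>\<^sup>+ y. \<integral>\<^sup>+ x. ennreal (jump_kernel \<nu> x y * v y) \<partial>lborel \<partial>lborel)"
    by (subst lborel_pair.Fubini') auto
  also have "\<dots> \<le> (\<integral>\<^sup>+ y. ennreal (1 / 4) * ennreal (v y) \<partial>lborel)"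
  proof (intro nn_integral_mono)
    fix y :: real
    show "(\<integral>\<^sup>+ x. ennreal (jump_kernel \<nu> x y * v y) \<partial>lborel) \<le> ennreal (1 / 4) * ennreal (v y)"
    proof (cases "y \<in> {0<..<b}")
      case True
      have "(\<integral>\<^sup>+ x. ennreal (jump_kernel \<nu> x y * v y) \<partial>lborel) =
          (\<integral>\<^sup>+ x. ennreal (jump_kernel \<nu> x y) \<partial>lborel) * ennreal (v y)"
        by (simp add: ennreal_mult nonneg nn_integral_multc)
      also have "\<dots> \<le> ennreal (y * jump_exponent \<nu>) * ennreal (v y)"
        using True by (intro mult_right_mono nn_integral_jump_kernel_left levy) auto
      also have "y * jump_exponent \<nu> \<le> b * jump_exponent \<nu>"
        using True by (intro mult_right_mono) auto
      then have "ennreal (y * jump_exponent \<nu>) * ennreal (v y) \<le> ennreal (1 / 4) * ennreal (v y)"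
        using small by (intro mult_right_mono ennreal_leI) auto
      finally show ?thesis .
    next
      case False
      then show ?thesis by (simp add: supp)
    qed
  qed
  also have "\<dots> = ennreal (1 / 4) * (\<integral>\<^sup>+ y. ennreal (v y) \<partial>lborel)"
    by (intro nn_integral_cmult) measurable
  finally have le: "(\<integral>\<^sup>+ x. ennreal (v x) \<partial>lborel) \<le>
      2 * (ennreal (1 / 4) * (\<integral>\<^sup>+ y. ennreal (v y) \<partial>lborel))"
    by (simp add: mult_left_mono)
  obtain t where t: "(\<integral>\<^sup>+ x. ennreal (v x) \<partial>lborel) = ennreal t" "0 \<le> t"
    using fin by (cases "(\<integral>\<^sup>+ x. ennreal (v x) \<partial>lborel)") auto
  have "ennreal t \<le> ennreal (2 * (1 / 4 * t))"
    using le t by (subst ennreal_mult', simp, subst ennreal_mult', simp) (simp only: ennreal_numeral)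
  then have "(\<integral>\<^sup>+ x. ennreal (v x) \<partial>lborel) = 0"
    using t by (simp add: ennreal_le_iff)
  then have "AE y in lborel. v y = 0"
    using nonneg by (subst (asm) nn_integral_0_iff_AE) (auto simp: ennreal_eq_0_iff intro: antisym)
  then have "(\<integral>\<^sup>+ y. ennreal (jump_kernel \<nu> x y * v y) \<partial>lborel) = (\<integral>\<^sup>+ y. 0 \<partial>(lborel::real measure))" for x
    by (intro nn_integral_cong_AE) auto
  then show ?thesis
    using sub[of x] supp[of x] nonneg[of x] by (auto simp: ennreal_eq_0_iff)
qed

text \<open>
  The weight \<open>b - x\<close> is split as \<open>(y - x) + (b - y)\<close> inside the jump integral. The first part cancels
  the singularity of the kernel on the diagonal and contributes a constant; the second reproduces the
  weighted density at \<open>y\<close>. What exceeds the constant \<open>D\<close> is a subsolution of the homogeneous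
  equation, and so vanishes.
\<close>

lemma density_bound_weighted:
  assumes "0 < b" "c * b \<le> 1 / 2" and small: "b * jump_exponent \<nu> \<le> 1 / 4"
    and "0 < x" "x < b"
  shows "(b - x) * k x \<le> 4 * (b * jump_exponent \<nu> + q * b)"
proof -
  \<comment> \<open>\<open>D\<close> absorbs the inhomogeneity \<open>D / 4\<close> and the
    contribution \<open>D b J \<le> D / 4\<close> of the constant, both doubled because
    \<open>1 - c x\<close> may be as small as \<open>1 / 2\<close>.\<close>
  define D where "D = 4 * (b * jump_exponent \<nu> + q * b)"
  define v where "v y = max 0 ((b - y) * k y - D) * indicator {0<..<b} y" for y
  have [measurable]: "v \<in> borel_measurable borel"
    unfolding v_def by measurable
  have "0 \<le> D"
    using assms rate_nonneg by (simp add: D_def)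
  have v_nonneg [simp]: "0 \<le> v y" for y
    by (auto simp: v_def)
  have "v x = 0"
  proof (rule jump_kernel_volterra_zero[OF assms(1) small, where v = v])
    have "(\<integral>\<^sup>+ x. ennreal (v x) \<partial>lborel) \<le> (\<integral>\<^sup>+ x. ennreal b * ennreal (k x) \<partial>lborel)"
      using assms(1) \<open>0 \<le> D\<close> by (intro nn_integral_mono)
        (auto simp: v_def algebra_simps max_def split: split_indicator simp flip: ennreal_mult
          intro!: ennreal_leI add_increasing2 add_nonneg_nonneg)
    also have "\<dots> < \<infinity>"
      by (simp add: nn_integral_cmult density_total)
    finally show "(\<integral>\<^sup>+ x. ennreal (v x) \<partial>lborel) < \<infinity>" .
  next
    fix x assume x: "x \<in> {0<..<b}"
    then have "c * x \<le> c * b"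
      using drift_nonneg by (intro mult_left_mono) auto
    then have cx: "c * x \<le> 1 / 2"
      using assms(2) by simp
    \<comment> \<open>The estimate behind the weight: \<open>b - x = (y - x) + (b - y)\<close> for \<open>x < y < b\<close>, and for
      \<open>y \<ge> b\<close> the kernel at \<open>y\<close> is at most the one at \<open>b\<close>.\<close>
    have pw: "(b - x) * (jump_kernel \<nu> x y * k y) \<le> b * jump_exponent \<nu> * k y
        + D * (jump_kernel \<nu> x y * indicator {..<b} y) + jump_kernel \<nu> x y * v y" for y
    proof (cases "x < y")
      case False
      then show ?thesis
        using assms(1) by (simp add: jump_kernel_def)
    next
      case True
      show ?thesis
      proof (cases "y < b")
        case yb: True
        have "(y - x) * jump_kernel \<nu> x y \<le> y * jump_exponent \<nu>"
          using True x by (intro jump_kernel_bound levy) auto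
        also have "\<dots> \<le> b * jump_exponent \<nu>"
          using yb by (intro mult_right_mono) auto
        finally have "(y - x) * jump_kernel \<nu> x y * k y \<le> b * jump_exponent \<nu> * k y"
          by (intro mult_right_mono) auto
        moreover have "(b - y) * k y \<le> D + v y"
          using True yb x by (simp add: v_def)
        then have "jump_kernel \<nu> x y * ((b - y) * k y) \<le> jump_kernel \<nu> x y * (D + v y)"
          by (intro mult_left_mono) auto
        ultimately show ?thesis
          using yb by (simp add: algebra_simps)
      next
        case False
        have "(b - x) * jump_kernel \<nu> x y \<le> (b - x) * jump_kernel \<nu> x b"
          using x False by (intro mult_left_mono jump_kernel_mono_right levy) auto
        also have "\<dots> \<le> b * jump_exponent \<nu>"
          using x by (intro jump_kernel_bound levy) auto
        finally have "(b - x) * jump_kernel \<nu> x y * k y \<le> b * jump_exponent \<nu> * k y"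
          by (intro mult_right_mono) auto
        then show ?thesis
          using False by (simp add: v_def mult.assoc)
      qed
    qed
    define T where "T = (\<integral>\<^sup>+ y. ennreal (jump_kernel \<nu> x y * v y) \<partial>lborel)"
    have "(\<integral>\<^sup>+ y. ennreal ((b - x) * (jump_kernel \<nu> x y * k y)) \<partial>lborel) \<le>
       (\<integral>\<^sup>+ y. ennreal (b * jump_exponent \<nu>) * ennreal (k y) +
          ennreal D * (ennreal (jump_kernel \<nu> x y) * indicator {..<b} y)
          + ennreal (jump_kernel \<nu> x y * v y) \<partial>lborel)"
    proof (intro nn_integral_mono)
      fix y
      show "ennreal ((b - x) * (jump_kernel \<nu> x y * k y)) \<le> ennreal (b * jump_exponent \<nu>) * ennreal (k y) +
          ennreal D * (ennreal (jump_kernel \<nu> x y) * indicator {..<b} y)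
          + ennreal (jump_kernel \<nu> x y * v y)"
        using ennreal_leI[OF pw[of y]] \<open>0 \<le> D\<close> assms(1)
        by (simp add: ennreal_plus ennreal_mult ennreal_indicator)
    qed
    also have "\<dots> = ennreal (b * jump_exponent \<nu>) +
        ennreal D * (\<integral>\<^sup>+ y \<in> {..<b}. ennreal (jump_kernel \<nu> x y) \<partial>lborel) + T"
      unfolding T_def by (simp add: nn_integral_add nn_integral_cmult density_total)
    also have "\<dots> \<le> ennreal (b * jump_exponent \<nu>) + ennreal D * ennreal (1 / 4) + T"
      using order_trans[OF nn_integral_jump_kernel_right[OF levy, of x b] ennreal_leI[OF small]] x
      by (intro add_mono mult_left_mono) auto
    also have "ennreal D * ennreal (1 / 4) = ennreal (D * (1 / 4))"
      using \<open>0 \<le> D\<close> by (intro ennreal_mult[symmetric]) auto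
    also have "ennreal (b * jump_exponent \<nu>) + \<dots> = ennreal (b * jump_exponent \<nu> + D * (1 / 4))"
      using \<open>0 \<le> D\<close> assms(1) by (intro ennreal_plus[symmetric]) auto
    finally have I: "(\<integral>\<^sup>+ y. ennreal ((b - x) * (jump_kernel \<nu> x y * k y)) \<partial>lborel) \<le>
        ennreal (b * jump_exponent \<nu> + D * (1 / 4)) + T" .
    have "ennreal ((b - x) * ((1 - c * x) * k x)) =
        ennreal (b - x) * ((\<integral>\<^sup>+ y. ennreal (jump_kernel \<nu> x y * k y) \<partial>lborel)
        + ennreal q * (\<integral>\<^sup>+ y \<in> {x<..}. ennreal (k y) \<partial>lborel))"
      using x cx by (subst ennreal_mult', simp, subst equation) auto
    also have "\<dots> = (\<integral>\<^sup>+ y. ennreal ((b - x) * (jump_kernel \<nu> x y * k y)) \<partial>lborel)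
        + ennreal ((b - x) * q) * (\<integral>\<^sup>+ y \<in> {x<..}. ennreal (k y) \<partial>lborel)"
      using x rate_nonneg
      by (simp add: distrib_left nn_integral_cmult[symmetric] ennreal_mult mult.assoc)
    also have "\<dots> \<le> (ennreal (b * jump_exponent \<nu> + D * (1 / 4)) + T) + ennreal (b * q) * 1"
      using x rate_nonneg by (intro add_mono I mult_mono density_tail_le_1 ennreal_leI mult_right_mono) auto
    also have "\<dots> = (ennreal (b * jump_exponent \<nu> + D * (1 / 4)) + ennreal (b * q)) + T"
      by (simp only: mult_1_right mult_1_left ac_simps)
    also have "ennreal (b * jump_exponent \<nu> + D * (1 / 4)) + ennreal (b * q) =
        ennreal (b * jump_exponent \<nu> + D * (1 / 4) + b * q)"
      using assms(1) rate_nonneg \<open>0 \<le> D\<close> by (intro ennreal_plus[symmetric]) auto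
    also have "b * jump_exponent \<nu> + D * (1 / 4) + b * q = D / 2"
      by (simp add: D_def field_simps)
    finally have II: "ennreal ((b - x) * ((1 - c * x) * k x)) \<le> ennreal (D / 2) + T" .
    show "ennreal (v x) \<le> 2 * (\<integral>\<^sup>+ y. ennreal (jump_kernel \<nu> x y * v y) \<partial>lborel)"
    proof (cases T)
      case (real t)
      then have "(b - x) * ((1 - c * x) * k x) \<le> D / 2 + t"
        using II \<open>0 \<le> D\<close> by (simp flip: ennreal_plus add: ennreal_le_iff)
      moreover have "(b - x) * k x * (1 / 2) \<le> (b - x) * k x * (1 - c * x)"
        using x cx by (intro mult_left_mono) auto
      ultimately have "v x \<le> 2 * t"
        using x real by (auto simp: v_def max_def algebra_simps)
      then have "ennreal (v x) \<le> ennreal (2 * t)"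
        by (rule ennreal_leI)
      also have "\<dots> = 2 * T"
        by (simp add: real ennreal_mult')
      finally show ?thesis
        by (simp only: T_def)
    qed (simp add: T_def[symmetric] ennreal_mult_top)
  qed (use assms in \<open>auto simp: v_def\<close>)
  then show ?thesis
    using assms by (auto simp: v_def D_def max_def split: if_splits)
qed

text \<open>
  The weighted bound degenerates at the right end \<open>b\<close> of the interval, so it is used on its left half.
\<close>

lemma density_bounded_near_0:
  obtains b K where "0 < b" "b < 1" "c * b \<le> 1 / 2" "0 < K" "\<And>x. x < b \<Longrightarrow> k x \<le> K"
proof -
  define B where "B = min 1 (min (1 / (2 * (c + 1))) (1 / (4 * (jump_exponent \<nu> + 1))))"
  have "0 < B" using drift_nonneg jump_exponent_nonneg[of \<nu>] by (auto simp: B_def intro: add_nonneg_pos)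
  have "c * B \<le> c * (1 / (2 * (c + 1)))"
    unfolding B_def using drift_nonneg by (intro mult_left_mono) auto
  also have "\<dots> \<le> 1 / 2" using drift_nonneg by (simp add: field_simps)
  finally have cB: "c * B \<le> 1 / 2" .
  have "B * jump_exponent \<nu> \<le> 1 / (4 * (jump_exponent \<nu> + 1)) * jump_exponent \<nu>"
    unfolding B_def by (intro mult_right_mono) auto
  also have "\<dots> \<le> 1 / 4"
    using jump_exponent_nonneg[of \<nu>] by (auto simp: field_simps simp del: jump_exponent_nonneg)
  finally have JB: "B * jump_exponent \<nu> \<le> 1 / 4" .
  define K where "K = 1 + 4 * (B * jump_exponent \<nu> + q * B) / (B / 2)"
  have "0 < K"
    unfolding K_def using \<open>0 < B\<close> rate_nonneg by (intro add_pos_nonneg) auto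
  show thesis
  proof (rule that[of "B / 2" K])
    show "0 < B / 2" "B / 2 < 1" using \<open>0 < B\<close> by (auto simp: B_def)
    show "c * (B / 2) \<le> 1 / 2" using cB drift_nonneg \<open>0 < B\<close>
      by (smt (verit) mult_left_mono field_sum_of_halves)
    fix x assume x: "x < B / 2"
    show "k x \<le> K"
    proof (cases "0 < x")
      case True
      have "(B / 2) * k x \<le> (B - x) * k x"
        using x by (intro mult_right_mono) auto
      also have "\<dots> \<le> 4 * (B * jump_exponent \<nu> + q * B)"
        using density_bound_weighted[OF \<open>0 < B\<close> cB JB] x True by simp
      finally show ?thesis
        using \<open>0 < B\<close> by (simp add: K_def field_simps)
    next
      case False
      then show ?thesis using \<open>0 < K\<close> by (simp add: density_zero)
    qed
  qed fact
qed

lemma jump_kernel_tendsto_0: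
  assumes "0 < y"
  shows "((\<lambda>x. jump_kernel \<nu> x y) \<longlongrightarrow> 0) (at_right 0)"
proof -
  have "((\<lambda>x. tail \<nu> (ln (y / x))) \<longlongrightarrow> 0) (at_right 0)"
    using assms by (intro filterlim_compose[OF tail_tendsto_0[OF levy]]) real_asymp
  moreover have "eventually (\<lambda>x. tail \<nu> (ln (y / x)) = jump_kernel \<nu> x y) (at_right 0)"
    using eventually_at_right_real[OF assms] by eventually_elim (auto simp: jump_kernel_def)
  ultimately show ?thesis
    by (rule Lim_transform_eventually)
qed

text \<open>
  As \<open>k\<close> is bounded near \<open>0\<close>, the jump term over \<open>(x, d)\<close> is at most a constant times \<open>d J\<close>, and the
  rest is at most the kernel at \<open>d\<close>, which tends to \<open>0\<close> with \<open>x\<close> for each fixed \<open>d\<close>. The mass of \<open>k\<close>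
  beyond \<open>x\<close>, the coefficient of \<open>q\<close>, tends to \<open>1\<close>.
\<close>

theorem density_tendsto_rate: "(k \<longlongrightarrow> q) (at_right 0)"
proof -
  obtain b K where b: "0 < b" "b < 1" "c * b \<le> 1 / 2" "0 < K" "\<And>x. x < b \<Longrightarrow> k x \<le> K"
    by (rule density_bounded_near_0) blast
  define T where "T x = enn2real (\<integral>\<^sup>+ y. ennreal (jump_kernel \<nu> x y * k y) \<partial>lborel)" for x
  define S where "S x = enn2real (\<integral>\<^sup>+ y \<in> {x<..}. ennreal (k y) \<partial>lborel)" for x
  have eq: "(1 - c * x) * k x = T x + q * S x" if "0 < x" "x < b" for x
  proof -
    have "c * x \<le> c * b" using that drift_nonneg by (intro mult_left_mono) auto
    then have cx: "c * x < 1" using b by simp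
    have fS: "(\<integral>\<^sup>+ y \<in> {x<..}. ennreal (k y) \<partial>lborel) < \<infinity>"
      using density_tail_le_1[of x] by (simp add: le_less_trans)
    have "(\<integral>\<^sup>+ y. ennreal (jump_kernel \<nu> x y * k y) \<partial>lborel) < \<infinity>"
      using equation[OF that(1) cx]
      by (metis ennreal_add_eq_top ennreal_neq_top infinity_ennreal_def less_top)
    then have "ennreal ((1 - c * x) * k x) = ennreal (T x) + ennreal q * ennreal (S x)"
      using equation[OF that(1) cx] fS by (simp add: T_def S_def)
    also have "\<dots> = ennreal (T x + q * S x)"
      using rate_nonneg by (simp add: T_def S_def ennreal_mult ennreal_plus)
    finally show ?thesis
      using cx rate_nonneg by (subst (asm) ennreal_inj) (auto simp: T_def S_def)
  qed
  have "(S \<longlongrightarrow> 1) (at_right 0)"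
  proof (rule tendsto_sandwich)
    show "eventually (\<lambda>x. S x \<le> 1) (at_right 0)"
      unfolding S_def using density_tail_le_1 by (intro always_eventually allI) (simp add: enn2real_leI)
    show "((\<lambda>x. 1 - K * x) \<longlongrightarrow> 1) (at_right 0)"
      by (auto intro!: tendsto_eq_intros)
    show "eventually (\<lambda>x. 1 - K * x \<le> S x) (at_right 0)"
      using eventually_at_right_real[OF b(1)]
    proof eventually_elim
      case (elim x)
      have "(\<integral>\<^sup>+ y. ennreal (k y) \<partial>lborel) \<le>
          (\<integral>\<^sup>+ y. ennreal K * indicator {0..x} y + ennreal (k y) * indicator {x<..} y \<partial>lborel)"
        using elim b by (intro nn_integral_mono)
          (auto split: split_indicator simp: density_zero intro!: ennreal_leI)
      also have "\<dots> = ennreal (K * x) + (\<integral>\<^sup>+ y \<in> {x<..}. ennreal (k y) \<partial>lborel)"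
        using elim b by (simp add: nn_integral_add nn_integral_cmult ennreal_mult)
      also have "\<dots> = ennreal (K * x) + ennreal (S x)"
        unfolding S_def using density_tail_le_1[of x]
        by (subst ennreal_enn2real) (auto simp: less_top[symmetric] top_unique)
      finally have "ennreal 1 \<le> ennreal (K * x + S x)"
        using elim b by (simp add: density_total S_def ennreal_plus)
      then show ?case
        using elim b by (subst (asm) ennreal_le_iff) (auto simp: S_def)
    qed
  qed auto
  moreover have "(T \<longlongrightarrow> 0) (at_right 0)"
  proof (rule order_tendstoI)
    fix \<epsilon> :: real assume "0 < \<epsilon>"
    define d where "d = min b (\<epsilon> / (2 * (K * (jump_exponent \<nu> + 1))))"
    have pos: "0 < K * (jump_exponent \<nu> + 1)"
      using b by (intro mult_pos_pos) (auto intro: add_nonneg_pos)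
    have d: "0 < d" "d \<le> b"
      using b pos \<open>0 < \<epsilon>\<close> by (auto simp: d_def)
    have "K * (d * jump_exponent \<nu>) \<le> d * (K * (jump_exponent \<nu> + 1))"
      using d b by (simp add: algebra_simps)
    also have "\<dots> \<le> \<epsilon> / (2 * (K * (jump_exponent \<nu> + 1))) * (K * (jump_exponent \<nu> + 1))"
      unfolding d_def using pos by (intro mult_right_mono) auto
    also have "\<dots> = \<epsilon> / 2"
      using pos by (simp add: field_simps)
    finally have near: "K * (d * jump_exponent \<nu>) \<le> \<epsilon> / 2" .
    have "eventually (\<lambda>x. jump_kernel \<nu> x d < \<epsilon> / 2) (at_right 0)"
      using order_tendstoD(2)[OF jump_kernel_tendsto_0[OF d(1)], of "\<epsilon> / 2"] \<open>0 < \<epsilon>\<close> by simp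
    with eventually_at_right_real[OF d(1)]
    show "eventually (\<lambda>x. T x < \<epsilon>) (at_right 0)"
    proof eventually_elim
      case (elim x)
      have "(\<integral>\<^sup>+ y \<in> {..<d}. ennreal (jump_kernel \<nu> x y * k y) \<partial>lborel) \<le>
          (\<integral>\<^sup>+ y. ennreal K * (ennreal (jump_kernel \<nu> x y) * indicator {..<d} y) \<partial>lborel)"
      proof (intro nn_integral_mono)
        fix y
        have "jump_kernel \<nu> x y * k y \<le> K * jump_kernel \<nu> x y" if "y < d"
          using mult_left_mono[OF b(5)[of y] jump_kernel_nonneg[of \<nu> x y]] that d by (simp add: mult.commute)
        then show "ennreal (jump_kernel \<nu> x y * k y) * indicator {..<d} y \<le>
            ennreal K * (ennreal (jump_kernel \<nu> x y) * indicator {..<d} y)"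
          using b by (auto split: split_indicator simp flip: ennreal_mult intro!: ennreal_leI)
      qed
      also have "\<dots> = ennreal K * (\<integral>\<^sup>+ y \<in> {..<d}. ennreal (jump_kernel \<nu> x y) \<partial>lborel)"
        by (simp add: nn_integral_cmult)
      also have "\<dots> \<le> ennreal K * ennreal (d * jump_exponent \<nu>)"
        using elim by (intro mult_left_mono nn_integral_jump_kernel_right levy) auto
      finally have "(\<integral>\<^sup>+ y. ennreal (jump_kernel \<nu> x y * k y) \<partial>lborel) \<le>
          ennreal K * ennreal (d * jump_exponent \<nu>) + ennreal (jump_kernel \<nu> x d)"
        using jump_term_split[of x d] elim by (meson add_right_mono greaterThanLessThan_iff order_trans)
      also have "\<dots> = ennreal (K * (d * jump_exponent \<nu>) + jump_kernel \<nu> x d)"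
        using b d by (simp add: ennreal_mult ennreal_plus)
      finally have "T x \<le> K * (d * jump_exponent \<nu>) + jump_kernel \<nu> x d"
        unfolding T_def using b d by (intro enn2real_leI) auto
      then show ?case
        using near elim by simp
    qed
  qed (auto simp: T_def intro!: always_eventually intro: less_le_trans[OF _ enn2real_nonneg])
  ultimately have "((\<lambda>x. (T x + q * S x) / (1 - c * x)) \<longlongrightarrow> (0 + q * 1) / (1 - c * 0)) (at_right 0)"
    by (intro tendsto_intros) auto
  moreover have "eventually (\<lambda>x. (T x + q * S x) / (1 - c * x) = k x) (at_right 0)"
    using eventually_at_right_real[OF b(1)]
  proof eventually_elim
    case (elim x)
    have "c * x \<le> c * b" using elim drift_nonneg by (intro mult_left_mono) auto
    then show ?case using eq[of x, symmetric] elim b by simp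
  qed
  ultimately show ?thesis
    by (simp add: Lim_transform_eventually)
qed

end

section \<open>Regularly varying tails\<close>

locale regular_density_equation = density_equation \<nu> c 0 k
  for \<nu> :: "real measure" and c :: real and k :: "real \<Rightarrow> real" +
  fixes \<alpha> :: real
  assumes index_nonneg: "0 \<le> \<alpha>"
    and tail_ratio: "((\<lambda>x. tail \<nu> (x + y) / tail \<nu> x) \<longlongrightarrow> exp (- \<alpha> * y)) at_top"
begin

text \<open>
  A tail that vanishes somewhere vanishes from there on; then all later ratios are \<open>0 / 0\<close>, which
  is \<open>0\<close> by convention, whereas the ratio for \<open>y = 0\<close> must tend to \<open>1\<close>.
\<close>

lemma tail_pos:
  assumes "0 < t"
  shows "0 < tail \<nu> t"
proof (rule ccontr)
  assume "\<not> 0 < tail \<nu> t"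
  then have "tail \<nu> t = 0"
    using tail_nonneg[of \<nu> t] by simp
  then have "tail \<nu> s = 0" if "t \<le> s" for s
    using tail_antimono[OF levy assms that] tail_nonneg[of \<nu> s] by simp
  then have "eventually (\<lambda>x. tail \<nu> (x + 0) / tail \<nu> x = 0) at_top"
    by (intro eventually_mono[OF eventually_ge_at_top[of t]]) simp
  then have "((\<lambda>x. tail \<nu> (x + 0) / tail \<nu> x) \<longlongrightarrow> 0) at_top"
    by (rule tendsto_eventually)
  with tail_ratio[of 0] show False
    using tendsto_unique[OF trivial_limit_at_top_linorder] by fastforce
qed

text \<open>
  Potter's bounds. The limit of the ratio for the step \<open>y = 1\<close> alone controls the tail along
  integer steps, with an arbitrarily small loss \<open>\<delta>\<close> in the exponent; monotonicity fills in
  the gaps at the cost of the constant factor \<open>exp (\<alpha> + \<delta>)\<close>.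
\<close>

lemma tail_potter_bounds:
  assumes "0 < \<delta>"
  obtains A t0 where "0 < A" "0 < t0"
    "\<And>s t. t0 \<le> s \<Longrightarrow> s \<le> t \<Longrightarrow> tail \<nu> s \<le> A * exp ((\<alpha> + \<delta>) * (t - s)) * tail \<nu> t"
    "\<And>s t. t0 \<le> s \<Longrightarrow> s \<le> t \<Longrightarrow> tail \<nu> t \<le> A * exp (- (\<alpha> - \<delta>) * (t - s)) * tail \<nu> s"
proof -
  have "eventually (\<lambda>t. exp (- (\<alpha> + \<delta>)) < tail \<nu> (t + 1) / tail \<nu> t) at_top"
    "eventually (\<lambda>t. tail \<nu> (t + 1) / tail \<nu> t < exp (- (\<alpha> - \<delta>))) at_top"
    using order_tendstoD[OF tail_ratio[of 1]] assms by auto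
  then have "eventually (\<lambda>t. exp (- (\<alpha> + \<delta>)) * tail \<nu> t \<le> tail \<nu> (t + 1) \<and>
      tail \<nu> (t + 1) \<le> exp (- (\<alpha> - \<delta>)) * tail \<nu> t) at_top"
    using eventually_gt_at_top[of 0]
    by eventually_elim (auto simp: tail_pos pos_less_divide_eq pos_divide_less_eq less_imp_le)
  then obtain u where u: "\<And>t. u \<le> t \<Longrightarrow> exp (- (\<alpha> + \<delta>)) * tail \<nu> t \<le> tail \<nu> (t + 1)"
      "\<And>t. u \<le> t \<Longrightarrow> tail \<nu> (t + 1) \<le> exp (- (\<alpha> - \<delta>)) * tail \<nu> t"
    unfolding eventually_at_top_linorder by blast
  define t0 where "t0 = max 1 u"
  have lower: "exp (- (\<alpha> + \<delta>) * real n) * tail \<nu> s \<le> tail \<nu> (s + real n)" if "t0 \<le> s" for s n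
  proof (induction n)
    case (Suc n)
    have "exp (- (\<alpha> + \<delta>) * real (Suc n)) * tail \<nu> s =
        exp (- (\<alpha> + \<delta>)) * (exp (- (\<alpha> + \<delta>) * real n) * tail \<nu> s)"
      by (simp add: algebra_simps flip: exp_add)
    also have "\<dots> \<le> exp (- (\<alpha> + \<delta>)) * tail \<nu> (s + real n)"
      using Suc by (intro mult_left_mono) auto
    also have "\<dots> \<le> tail \<nu> (s + real n + 1)"
      using that by (intro u) (auto simp: t0_def)
    finally show ?case by (simp add: add_ac)
  qed simp
  have upper: "tail \<nu> (s + real n) \<le> exp (- (\<alpha> - \<delta>) * real n) * tail \<nu> s" if "t0 \<le> s" for s n
  proof (induction n)
    case (Suc n)
    have "tail \<nu> (s + real n + 1) \<le> exp (- (\<alpha> - \<delta>)) * tail \<nu> (s + real n)"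
      using that by (intro u) (auto simp: t0_def)
    also have "\<dots> \<le> exp (- (\<alpha> - \<delta>)) * (exp (- (\<alpha> - \<delta>) * real n) * tail \<nu> s)"
      using Suc by (intro mult_left_mono) auto
    also have "\<dots> = exp (- (\<alpha> - \<delta>) * real (Suc n)) * tail \<nu> s"
      by (simp add: algebra_simps flip: exp_add)
    finally show ?case by (simp add: add_ac)
  qed simp
  show thesis
  proof (rule that[of "exp (\<alpha> + \<delta>)" t0])
    show "0 < t0" by (simp add: t0_def)
    fix s t assume st: "t0 \<le> s" "s \<le> t"
    define n where "n = nat \<lfloor>t - s\<rfloor>"
    have n: "real n \<le> t - s" "t - s \<le> real n + 1"
      using st by (auto simp: n_def)
    have "0 < s" using st by (simp add: t0_def)
    have "tail \<nu> s = exp ((\<alpha> + \<delta>) * real (Suc n)) * (exp (- (\<alpha> + \<delta>) * real (Suc n)) * tail \<nu> s)"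
      by (simp only: mult.assoc[symmetric] exp_add[symmetric]) (simp add: algebra_simps)
    also have "\<dots> \<le> exp ((\<alpha> + \<delta>) * real (Suc n)) * tail \<nu> (s + real (Suc n))"
      using lower[OF st(1), of "Suc n"] by (intro mult_left_mono) auto
    also have "\<dots> \<le> exp ((\<alpha> + \<delta>) * (t - s + 1)) * tail \<nu> t"
      using n index_nonneg assms st \<open>0 < s\<close>
      by (intro mult_mono tail_antimono[OF levy]) (auto intro!: mult_left_mono)
    also have "\<dots> = exp (\<alpha> + \<delta>) * exp ((\<alpha> + \<delta>) * (t - s)) * tail \<nu> t"
      by (simp only: exp_add[symmetric]) (simp add: algebra_simps)
    finally show "tail \<nu> s \<le> exp (\<alpha> + \<delta>) * exp ((\<alpha> + \<delta>) * (t - s)) * tail \<nu> t" .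
    have "(\<alpha> - \<delta>) * (t - s - real n) \<le> (\<alpha> + \<delta>) * 1"
      using n index_nonneg assms
      by (intro order_trans[OF mult_right_mono[of "\<alpha> - \<delta>" "\<alpha> + \<delta>"] mult_left_mono]) auto
    then have e: "- (\<alpha> - \<delta>) * real n \<le> (\<alpha> + \<delta>) + - (\<alpha> - \<delta>) * (t - s)"
      by (simp add: algebra_simps)
    have "tail \<nu> t \<le> tail \<nu> (s + real n)"
      using n \<open>0 < s\<close> by (intro tail_antimono[OF levy]) auto
    also have "\<dots> \<le> exp (- (\<alpha> - \<delta>) * real n) * tail \<nu> s"
      by (rule upper) fact
    also have "\<dots> \<le> exp ((\<alpha> + \<delta>) + - (\<alpha> - \<delta>) * (t - s)) * tail \<nu> s"
      using e by (intro mult_right_mono) (simp_all only: exp_le_cancel_iff tail_nonneg)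
    finally show "tail \<nu> t \<le> exp (\<alpha> + \<delta>) * exp (- (\<alpha> - \<delta>) * (t - s)) * tail \<nu> s"
      by (simp only: exp_add)
  qed simp
qed

text \<open>
  The tail in multiplicative form, \<open>L x = tail \<nu> (ln (1 / x))\<close> for \<open>0 < x < 1\<close>; it is regularly varying
  of index \<open>\<alpha>\<close> at \<open>0\<close>.
\<close>

abbreviation L :: "real \<Rightarrow> real" where "L x \<equiv> jump_kernel \<nu> x 1"

lemma jump_kernel_eq_L: "0 < y \<Longrightarrow> jump_kernel \<nu> x y = L (x / y)"
  by (auto simp: jump_kernel_def field_simps)

lemma L_pos: "0 < x \<Longrightarrow> x < 1 \<Longrightarrow> 0 < L x"
  by (auto simp: jump_kernel_def intro!: tail_pos)

lemma L_mono: "0 < x \<Longrightarrow> x \<le> y \<Longrightarrow> y < 1 \<Longrightarrow> L x \<le> L y"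
  by (auto simp: jump_kernel_def field_simps intro!: tail_antimono levy)

lemma L_potter_bounds:
  assumes "0 < \<delta>"
  obtains A x0 where "0 < A" "0 < x0" "x0 < 1"
    "\<And>x y. 0 < x \<Longrightarrow> x \<le> y \<Longrightarrow> y \<le> x0 \<Longrightarrow> L y \<le> A * (y / x) powr (\<alpha> + \<delta>) * L x"
    "\<And>x y. 0 < x \<Longrightarrow> x \<le> y \<Longrightarrow> y \<le> x0 \<Longrightarrow> L x \<le> A * (x / y) powr (\<alpha> - \<delta>) * L y"
proof -
  obtain A t0 where A: "0 < A" "0 < t0"
    "\<And>s t. t0 \<le> s \<Longrightarrow> s \<le> t \<Longrightarrow> tail \<nu> s \<le> A * exp ((\<alpha> + \<delta>) * (t - s)) * tail \<nu> t"
    "\<And>s t. t0 \<le> s \<Longrightarrow> s \<le> t \<Longrightarrow> tail \<nu> t \<le> A * exp (- (\<alpha> - \<delta>) * (t - s)) * tail \<nu> s"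
    using tail_potter_bounds[OF assms] by blast
  show thesis
  proof (rule that[of A "exp (- t0)"])
    show "exp (- t0) < 1" using A by simp
    fix x y :: real assume xy: "0 < x" "x \<le> y" "y \<le> exp (- t0)"
    then have "y < 1" using A by (simp add: le_less_trans)
    have "ln y \<le> - t0"
      using xy by (subst exp_le_cancel_iff[symmetric]) simp
    then have s: "t0 \<le> ln (1 / y)" "ln (1 / y) \<le> ln (1 / x)"
      using xy by (auto simp: ln_div)
    have d: "ln (1 / x) - ln (1 / y) = ln (y / x)"
      using xy by (simp add: ln_div)
    have d': "- (\<alpha> - \<delta>) * ln (y / x) = (\<alpha> - \<delta>) * ln (x / y)"
      using xy by (simp add: ln_div algebra_simps)
    show "L y \<le> A * (y / x) powr (\<alpha> + \<delta>) * L x"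
      using A(3)[OF s] xy \<open>y < 1\<close> unfolding d by (simp add: powr_def jump_kernel_def)
    show "L x \<le> A * (x / y) powr (\<alpha> - \<delta>) * L y"
      using A(4)[OF s] xy \<open>y < 1\<close> unfolding d d' by (simp add: powr_def jump_kernel_def)
  qed (use A in auto)
qed

lemma jump_kernel_ratio:
  assumes "0 < y"
  shows "((\<lambda>x. jump_kernel \<nu> x y / L x) \<longlongrightarrow> y powr - \<alpha>) (at_right 0)"
proof -
  have "filterlim (\<lambda>x::real. ln (1 / x)) at_top (at_right 0)"
    by real_asymp
  from filterlim_compose[OF tail_ratio[of "ln y"] this]
  have "((\<lambda>x. tail \<nu> (ln (1 / x) + ln y) / tail \<nu> (ln (1 / x))) \<longlongrightarrow> y powr - \<alpha>) (at_right 0)"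
    using assms by (simp add: powr_def)
  moreover have "eventually (\<lambda>x. tail \<nu> (ln (1 / x) + ln y) / tail \<nu> (ln (1 / x)) =
      jump_kernel \<nu> x y / L x) (at_right 0)"
    using eventually_at_right_real[OF assms] eventually_at_right_real[of 0 "1::real", simplified]
    by eventually_elim (auto simp: jump_kernel_def ln_div)
  ultimately show ?thesis
    by (rule Lim_transform_eventually)
qed

lemma nn_integral_inverse_sqrt:
  fixes d :: real
  assumes "0 \<le> d"
  shows "(\<integral>\<^sup>+ y \<in> {0<..<d}. ennreal (y powr - (1 / 2)) \<partial>lborel) \<le> ennreal (2 * sqrt d)"
proof -
  have "((\<lambda>y. y powr (- (1 / 2))) has_integral (d powr (- (1 / 2) + 1) / (- (1 / 2) + 1))) {0..d}"
    using assms by (intro has_integral_powr_from_0) auto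
  then have "((\<lambda>y. y powr (- (1 / 2))) has_integral (2 * sqrt d)) {0..d}"
    using assms by (simp add: powr_half_sqrt mult.commute)
  then have "(\<integral>\<^sup>+ y. ennreal (indicator {0..d} y * y powr (- (1 / 2))) \<partial>lborel) = ennreal (2 * sqrt d)"
    by (intro nn_integral_has_integral_lebesgue) auto
  then show ?thesis
    by (intro order_trans[OF nn_integral_mono eq_refl]) (auto split: split_indicator)
qed

text \<open>
  The three estimates that make \<open>L\<close> comparable with the solution. The loss \<open>\<delta> = 1 / 4\<close> in Potter's
  bounds, incurred twice in the product \<open>L (x / y) * L y\<close>, leaves the power \<open>- 1 / 2\<close> of \<open>y\<close>, which is
  integrable at \<open>0\<close>. This needs \<open>x / y\<close> to be small; on the remaining range \<open>x0 * y \<le> x\<close> the kernel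
  may be singular, but there \<open>L y\<close> and \<open>L x\<close> are comparable.
\<close>

definition comparison_constants :: "real \<Rightarrow> real \<Rightarrow> real \<Rightarrow> bool" where
  "comparison_constants x0 A1 A2 \<longleftrightarrow> 0 < x0 \<and> x0 < 1 \<and> 0 < A1 \<and> 0 < A2 \<and>
    (\<forall>x y. 0 < x \<longrightarrow> x \<le> x0 * y \<longrightarrow> y \<le> x0 \<longrightarrow>
      jump_kernel \<nu> x y * L y \<le> A1 * y powr - (1 / 2) * L x) \<and>
    (\<forall>x y. 0 < x \<longrightarrow> x \<le> y \<longrightarrow> x0 * y \<le> x \<longrightarrow> y \<le> x0 \<longrightarrow> L y \<le> A2 * L x) \<and>
    (\<forall>x y. 0 < x \<longrightarrow> x \<le> x0 * y \<longrightarrow> y \<le> 1 \<longrightarrow>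
      jump_kernel \<nu> x y \<le> A2 * (1 / y) powr (\<alpha> + 1 / 4) * L x)"

lemma comparison_constantsD:
  assumes "comparison_constants x0 A1 A2"
  shows "0 < x0" "x0 < 1" "0 < A1" "0 < A2"
    "0 < x \<Longrightarrow> x \<le> x0 * y \<Longrightarrow> y \<le> x0 \<Longrightarrow>
      jump_kernel \<nu> x y * L y \<le> A1 * y powr - (1 / 2) * L x"
    "0 < x \<Longrightarrow> x \<le> y \<Longrightarrow> x0 * y \<le> x \<Longrightarrow> y \<le> x0 \<Longrightarrow> L y \<le> A2 * L x"
    "0 < x \<Longrightarrow> x \<le> x0 * y \<Longrightarrow> y \<le> 1 \<Longrightarrow>
      jump_kernel \<nu> x y \<le> A2 * (1 / y) powr (\<alpha> + 1 / 4) * L x"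
  using assms unfolding comparison_constants_def by blast+

lemma comparison_constants_exist: "\<exists>x0 A1 A2. comparison_constants x0 A1 A2"
proof -
  obtain A x0 where A: "0 < A" "0 < x0" "x0 < 1"
    "\<And>x y. 0 < x \<Longrightarrow> x \<le> y \<Longrightarrow> y \<le> x0 \<Longrightarrow> L y \<le> A * (y / x) powr (\<alpha> + 1 / 4) * L x"
    "\<And>x y. 0 < x \<Longrightarrow> x \<le> y \<Longrightarrow> y \<le> x0 \<Longrightarrow> L x \<le> A * (x / y) powr (\<alpha> - 1 / 4) * L y"
    using L_potter_bounds[of "1 / 4"] by (metis zero_less_divide_1_iff zero_less_numeral)
  define A1 where "A1 = A * (A * x0 powr (1 / 4 - \<alpha>) * L x0)"
  define A2 where "A2 = A * (1 / x0) powr (\<alpha> + 1 / 4)"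
  have "1 \<le> (1 / x0) powr (\<alpha> + 1 / 4)"
    using A index_nonneg by (intro ge_one_powr_ge_zero) auto
  then have "A \<le> A2"
    using A mult_left_mono[of 1 "(1 / x0) powr (\<alpha> + 1 / 4)" A] by (simp add: A2_def)
  have kb: "jump_kernel \<nu> x y \<le> A * (1 / y) powr (\<alpha> + 1 / 4) * L x"
    if "0 < x" "x \<le> x0 * y" "y \<le> 1" for x y
  proof -
    have "0 < y" using that A by (meson less_le_trans zero_less_mult_pos)
    then have "L (x / y) \<le> A * (x / y / x) powr (\<alpha> + 1 / 4) * L x"
      using that by (intro A) (auto simp: field_simps)
    then show ?thesis
      using that jump_kernel_eq_L[OF \<open>0 < y\<close>, of x] by simp
  qed
  have "comparison_constants x0 A1 A2"
    unfolding comparison_constants_def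
  proof (intro conjI allI impI)
    show "0 < A1" "0 < A2"
      using A L_pos[of x0] by (auto simp: A1_def A2_def)
  next
    fix x y assume xy: "0 < x" "x \<le> x0 * y" "y \<le> x0"
    have y: "0 < y" using xy A by (meson less_le_trans zero_less_mult_pos)
    have "L y \<le> A * (y / x0) powr (\<alpha> - 1 / 4) * L x0"
      using xy y by (intro A) auto
    also have "(y / x0) powr (\<alpha> - 1 / 4) = y powr (\<alpha> - 1 / 4) * x0 powr (1 / 4 - \<alpha>)"
      using y A by (simp add: powr_divide powr_diff)
    finally have "jump_kernel \<nu> x y * L y \<le> (A * (1 / y) powr (\<alpha> + 1 / 4) * L x) *
        (A * (y powr (\<alpha> - 1 / 4) * x0 powr (1 / 4 - \<alpha>)) * L x0)"
      using xy A y by (intro mult_mono kb) auto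
    also have "\<dots> = A1 * ((1 / y) powr (\<alpha> + 1 / 4) * y powr (\<alpha> - 1 / 4)) * L x"
      by (simp add: A1_def)
    also have "(1 / y) powr (\<alpha> + 1 / 4) * y powr (\<alpha> - 1 / 4) = y powr - (1 / 2)"
      using y by (simp add: powr_divide powr_minus_divide[symmetric] powr_add[symmetric])
    finally show "jump_kernel \<nu> x y * L y \<le> A1 * y powr - (1 / 2) * L x" .
  next
    fix x y assume xy: "0 < x" "x \<le> y" "x0 * y \<le> x" "y \<le> x0"
    have "L y \<le> A * (y / x) powr (\<alpha> + 1 / 4) * L x"
      using xy by (intro A) auto
    also have "\<dots> \<le> A * (1 / x0) powr (\<alpha> + 1 / 4) * L x"
      using xy A index_nonneg
      by (intro mult_right_mono mult_left_mono powr_mono2) (auto simp: field_simps)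
    finally show "L y \<le> A2 * L x" by (simp add: A2_def)
  next
    fix x y assume xy: "0 < x" "x \<le> x0 * y" "y \<le> 1"
    have "A * (1 / y) powr (\<alpha> + 1 / 4) * L x \<le> A2 * (1 / y) powr (\<alpha> + 1 / 4) * L x"
      using \<open>A \<le> A2\<close> by (intro mult_right_mono) auto
    then show "jump_kernel \<nu> x y \<le> A2 * (1 / y) powr (\<alpha> + 1 / 4) * L x"
      using kb[OF xy] by simp
  qed fact+
  then show ?thesis by blast
qed

text \<open>
  Near the diagonal the bound on \<open>k\<close> by \<open>R * L\<close> becomes a bound by a multiple of \<open>L x\<close>, and the
  integral of the kernel alone remains.
\<close>

lemma nn_integral_jump_kernel_near:
  assumes const: "comparison_constants x0 A1 A2"
    and "0 \<le> R" "d \<le> x0" "0 < x" "e \<le> d" "x0 * e \<le> x"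
    and kR: "\<And>y. x < y \<Longrightarrow> y < d \<Longrightarrow> k y \<le> R * L y"
  shows "(\<integral>\<^sup>+ y \<in> {..<e}. ennreal (jump_kernel \<nu> x y * k y) \<partial>lborel) \<le>
    ennreal (R * A2 * (e * jump_exponent \<nu>) * L x)"
proof -
  note A = comparison_constantsD(1-4)[OF const] and L2 = comparison_constantsD(6)[OF const]
  have "(\<integral>\<^sup>+ y \<in> {..<e}. ennreal (jump_kernel \<nu> x y * k y) \<partial>lborel) \<le>
      (\<integral>\<^sup>+ y. ennreal (R * A2 * L x) * (ennreal (jump_kernel \<nu> x y) * indicator {..<e} y) \<partial>lborel)"
  proof (intro nn_integral_mono)
    fix y
    have "jump_kernel \<nu> x y * k y \<le> R * A2 * L x * jump_kernel \<nu> x y" if "y < e"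
    proof (cases "x < y")
      case True
      have "x0 * y \<le> x0 * e" using that A by (intro mult_left_mono) auto
      then have "x0 * y \<le> x" using assms A by linarith
      then have "R * L y \<le> R * (A2 * L x)"
        using True that assms A by (intro mult_left_mono L2) auto
      moreover have "k y \<le> R * L y"
        using True that assms by (intro kR) auto
      ultimately have "k y \<le> R * A2 * L x"
        by (simp only: mult.assoc)
      then show ?thesis
        by (subst mult.commute) (rule mult_right_mono, auto)
    next
      case False
      then show ?thesis by (simp add: jump_kernel_def)
    qed
    then show "ennreal (jump_kernel \<nu> x y * k y) * indicator {..<e} y \<le>
        ennreal (R * A2 * L x) * (ennreal (jump_kernel \<nu> x y) * indicator {..<e} y)"
      using assms A by (auto split: split_indicator simp flip: ennreal_mult intro!: ennreal_leI)
  qed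
  also have "\<dots> = ennreal (R * A2 * L x) * (\<integral>\<^sup>+ y \<in> {..<e}. ennreal (jump_kernel \<nu> x y) \<partial>lborel)"
    by (simp add: nn_integral_cmult)
  also have "\<dots> \<le> ennreal (R * A2 * L x) * ennreal (e * jump_exponent \<nu>)"
    using assms A by (intro mult_left_mono nn_integral_jump_kernel_right levy) auto
  also have "\<dots> = ennreal (R * A2 * (e * jump_exponent \<nu>) * L x)"
    using assms A by (subst ennreal_mult'[symmetric]) (auto simp: algebra_simps)
  finally show ?thesis .
qed

text \<open>
  Away from the diagonal the powers of \<open>y\<close> in the comparison of \<open>jump_kernel \<nu> x y * L y\<close> with \<open>L x\<close>
  can be integrated.
\<close>

lemma nn_integral_jump_kernel_far:
  assumes const: "comparison_constants x0 A1 A2"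
    and "0 \<le> R" "0 \<le> d" "d \<le> x0" "0 < x" "x \<le> x0 * e"
    and kR: "\<And>y. x < y \<Longrightarrow> y < d \<Longrightarrow> k y \<le> R * L y"
  shows "(\<integral>\<^sup>+ y \<in> {e..<d}. ennreal (jump_kernel \<nu> x y * k y) \<partial>lborel) \<le>
    ennreal (R * A1 * (2 * sqrt d) * L x)"
proof -
  note A = comparison_constantsD(1-4)[OF const] and L1 = comparison_constantsD(5)[OF const]
  have "(\<integral>\<^sup>+ y \<in> {e..<d}. ennreal (jump_kernel \<nu> x y * k y) \<partial>lborel) \<le>
      (\<integral>\<^sup>+ y. ennreal (R * A1 * L x) * (ennreal (y powr - (1 / 2)) * indicator {0<..<d} y) \<partial>lborel)"
  proof (intro nn_integral_mono)
    fix y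
    have *: "0 < y \<and> jump_kernel \<nu> x y * k y \<le> R * A1 * L x * y powr - (1 / 2)" if "e \<le> y" "y < d"
    proof -
      have "x0 * e \<le> x0 * y" using that A by (intro mult_left_mono) auto
      then have xy: "x \<le> x0 * y" using assms A by linarith
      have y: "0 < y" using xy assms A by (meson less_le_trans zero_less_mult_pos)
      show ?thesis
      proof (cases "x < y")
        case True
        have "jump_kernel \<nu> x y * k y \<le> jump_kernel \<nu> x y * (R * L y)"
          using kR[of y] True that by (intro mult_left_mono) auto
        also have "\<dots> = R * (jump_kernel \<nu> x y * L y)" by simp
        also have "\<dots> \<le> R * (A1 * y powr - (1 / 2) * L x)"
          using xy assms that by (intro mult_left_mono L1) auto
        finally show ?thesis using y by (simp add: ac_simps)
      next
        case False
        then show ?thesis using y assms A by (simp add: jump_kernel_def)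
      qed
    qed
    show "ennreal (jump_kernel \<nu> x y * k y) * indicator {e..<d} y \<le>
        ennreal (R * A1 * L x) * (ennreal (y powr - (1 / 2)) * indicator {0<..<d} y)"
    proof (cases "e \<le> y \<and> y < d")
      case True
      then show ?thesis
        using * assms A by (auto simp flip: ennreal_mult intro!: ennreal_leI)
    qed auto
  qed
  also have "\<dots> = ennreal (R * A1 * L x) * (\<integral>\<^sup>+ y \<in> {0<..<d}. ennreal (y powr - (1 / 2)) \<partial>lborel)"
    by (simp add: nn_integral_cmult)
  also have "\<dots> \<le> ennreal (R * A1 * L x) * ennreal (2 * sqrt d)"
    using assms A by (intro mult_left_mono nn_integral_inverse_sqrt) auto
  also have "\<dots> = ennreal (R * A1 * (2 * sqrt d) * L x)"
    using assms A by (subst ennreal_mult'[symmetric]) (auto simp: algebra_simps)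
  finally show ?thesis .
qed

text \<open>
  On \<open>[x, d)\<close> the supremum \<open>r\<close> of \<open>k / L\<close> is finite, since \<open>k\<close> is bounded and \<open>L\<close> is bounded below. If
  \<open>d\<close> is small, the equation bounds \<open>k / L\<close> at points close to \<open>0\<close> by \<open>r / 2\<close> plus a constant, because
  the ratio at a point depends only on its values further right. Hence \<open>r\<close> is bounded
  independently of \<open>x\<close>.
\<close>

lemma density_le_L:
  assumes const: "comparison_constants x0 A1 A2"
  obtains d R where "0 < d" "d \<le> x0" "c * d \<le> 1 / 2" "0 \<le> R"
    "\<And>x. 0 < x \<Longrightarrow> x < d \<Longrightarrow> k x \<le> R * L x"
proof -
  note x0 = comparison_constantsD(1,2)[OF const] and A = comparison_constantsD(3,4)[OF const]
    and L3 = comparison_constantsD(7)[OF const]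
  obtain b K where b: "0 < b" "b < 1" "c * b \<le> 1 / 2" "0 < K" "\<And>x. x < b \<Longrightarrow> k x \<le> K"
    by (rule density_bounded_near_0) blast
  have "((\<lambda>d. A1 * (2 * sqrt d) + A2 * (d * jump_exponent \<nu>)) \<longlongrightarrow> 0) (at_right 0)"
    by (auto intro!: tendsto_eq_intros)
  from order_tendstoD(2)[OF this, of "1 / 4"]
  have "eventually (\<lambda>d. A1 * (2 * sqrt d) + A2 * (d * jump_exponent \<nu>) < 1 / 4) (at_right 0)"
    by simp
  moreover have "eventually (\<lambda>d. d \<in> {0<..<min b x0}) (at_right 0)"
    using b x0 by (intro eventually_at_right_real) auto
  ultimately have "eventually (\<lambda>d. A1 * (2 * sqrt d) + A2 * (d * jump_exponent \<nu>) < 1 / 4 \<and>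
      0 < d \<and> d < b \<and> d < x0) (at_right 0)"
    by eventually_elim auto
  then obtain d where d: "A1 * (2 * sqrt d) + A2 * (d * jump_exponent \<nu>) < 1 / 4"
      "0 < d" "d < b" "d < x0"
    using eventually_happens'[OF trivial_limit_at_right_real] by blast
  define \<epsilon> where "\<epsilon> = x0 * d"
  have \<epsilon>: "0 < \<epsilon>" "\<epsilon> < d"
    using x0 d by (auto simp: \<epsilon>_def)
  define M where "M = A2 * (1 / d) powr (\<alpha> + 1 / 4)"
  define R where "R = max (4 * M) (K / L \<epsilon>)"
  have "0 \<le> M" using A by (simp add: M_def)
  have cd: "c * x \<le> 1 / 2" if "x < d" for x
  proof -
    have "c * x \<le> c * b" using that d drift_nonneg by (intro mult_left_mono) auto
    then show ?thesis using b by simp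
  qed
  \<comment> \<open>Below \<open>\<epsilon> = x0 * d\<close> the interval \<open>(x, d)\<close> contains the splitting point \<open>x / x0\<close>, on whose two sides
    the two comparison estimates apply.\<close>
  have recur: "k x \<le> (r / 2 + 2 * M) * L x"
    if x: "0 < x" "x < \<epsilon>" and r: "0 \<le> r" and kr: "\<And>y. x < y \<Longrightarrow> y < d \<Longrightarrow> k y \<le> r * L y" for x r
  proof -
    have xd: "x < d" using x \<epsilon> by simp
    have xe: "x / x0 \<le> d" using x x0 by (simp add: \<epsilon>_def field_simps)
    have "ennreal ((1 - c * x) * k x) = (\<integral>\<^sup>+ y. ennreal (jump_kernel \<nu> x y * k y) \<partial>lborel)"
      using x cd[OF xd] by (subst equation) auto
    also have "\<dots> \<le> (\<integral>\<^sup>+ y \<in> {..<d}. ennreal (jump_kernel \<nu> x y * k y) \<partial>lborel) + ennreal (jump_kernel \<nu> x d)"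
      by (rule jump_term_split) fact
    also have "(\<integral>\<^sup>+ y \<in> {..<d}. ennreal (jump_kernel \<nu> x y * k y) \<partial>lborel) \<le>
        (\<integral>\<^sup>+ y. ennreal (jump_kernel \<nu> x y * k y) * indicator {..<x / x0} y +
          ennreal (jump_kernel \<nu> x y * k y) * indicator {x / x0..<d} y \<partial>lborel)"
      by (intro nn_integral_mono) (auto split: split_indicator)
    also have "\<dots> = (\<integral>\<^sup>+ y \<in> {..<x / x0}. ennreal (jump_kernel \<nu> x y * k y) \<partial>lborel) +
        (\<integral>\<^sup>+ y \<in> {x / x0..<d}. ennreal (jump_kernel \<nu> x y * k y) \<partial>lborel)"
      by (intro nn_integral_add) auto
    also have "\<dots> \<le> ennreal (r * A2 * (x / x0 * jump_exponent \<nu>) * L x) +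
        ennreal (r * A1 * (2 * sqrt d) * L x)"
    proof (rule add_mono)
      show "(\<integral>\<^sup>+ y \<in> {..<x / x0}. ennreal (jump_kernel \<nu> x y * k y) \<partial>lborel) \<le>
          ennreal (r * A2 * (x / x0 * jump_exponent \<nu>) * L x)"
        by (rule nn_integral_jump_kernel_near[OF const, of r d x "x / x0"])
          (use x0 A r d x xe kr in auto)
      show "(\<integral>\<^sup>+ y \<in> {x / x0..<d}. ennreal (jump_kernel \<nu> x y * k y) \<partial>lborel) \<le>
          ennreal (r * A1 * (2 * sqrt d) * L x)"
        by (rule nn_integral_jump_kernel_far[OF const, of r d x "x / x0"])
          (use x0 A r d x xe kr in auto)
    qed
    also have "jump_kernel \<nu> x d \<le> M * L x"
      unfolding M_def using x d b x0 by (intro L3) (auto simp: \<epsilon>_def)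
    finally have "ennreal ((1 - c * x) * k x) \<le> ennreal (r * A2 * (x / x0 * jump_exponent \<nu>) * L x) +
        ennreal (r * A1 * (2 * sqrt d) * L x) + ennreal (M * L x)"
      by (simp add: add_left_mono add_right_mono ennreal_leI)
    also have "\<dots> = ennreal (r * A2 * (x / x0 * jump_exponent \<nu>) * L x + r * A1 * (2 * sqrt d) * L x + M * L x)"
      using x0 A r x d \<open>0 \<le> M\<close> by (simp add: ennreal_plus)
    finally have "(1 - c * x) * k x \<le> r * A2 * (x / x0 * jump_exponent \<nu>) * L x + r * A1 * (2 * sqrt d) * L x + M * L x"
      using x0 A r x d \<open>0 \<le> M\<close> by (subst (asm) ennreal_le_iff) auto
    also have "r * A2 * (x / x0 * jump_exponent \<nu>) * L x \<le> r * A2 * (d * jump_exponent \<nu>) * L x"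
      using xe A r by (intro mult_right_mono mult_left_mono) auto
    also have "r * A2 * (d * jump_exponent \<nu>) * L x + r * A1 * (2 * sqrt d) * L x + M * L x =
        (r * (A1 * (2 * sqrt d) + A2 * (d * jump_exponent \<nu>)) + M) * L x"
      by (simp add: algebra_simps)
    also have "\<dots> \<le> (r * (1 / 4) + M) * L x"
      using d r by (intro mult_right_mono add_right_mono mult_left_mono) auto
    finally have "(1 - c * x) * k x \<le> (r * (1 / 4) + M) * L x" by simp
    moreover have "1 / 2 * k x \<le> (1 - c * x) * k x"
      using cd[OF xd] by (intro mult_right_mono) auto
    ultimately show ?thesis by (simp add: algebra_simps)
  qed
  show thesis
  proof (rule that[of d R])
    show "0 \<le> R" using \<open>0 \<le> M\<close> by (simp add: R_def max_def)
    show "c * d \<le> 1 / 2" using b d drift_nonneg by (meson less_imp_le mult_left_mono order_trans)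
    fix x assume x: "0 < x" "x < d"
    \<comment> \<open>The supremum is taken over \<open>[x, d)\<close> and not over \<open>(0, d)\<close>, where it is not yet known to be finite.\<close>
    define ratios where "ratios = (\<lambda>y. k y / L y) ` {x..<d}"
    define r where "r = Sup ratios"
    have Lpos: "0 < L y" if "x \<le> y" "y < d" for y
      using that x d x0 by (intro L_pos) auto
    have "k y / L y \<le> K / L x" if "x \<le> y" "y < d" for y
      using that b d x0 x Lpos by (intro frac_le L_mono) auto
    then have bdd: "bdd_above ratios"
      by (auto simp: ratios_def intro!: bdd_aboveI2)
    have kr: "k y \<le> r * L y" if "x \<le> y" "y < d" for y
    proof -
      have "k y / L y \<le> r"
        unfolding r_def using that by (intro cSup_upper bdd) (auto simp: ratios_def)
      then show ?thesis using Lpos[OF that] by (simp add: pos_divide_le_eq)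
    qed
    have "0 \<le> k x / L x" by simp
    also have "\<dots> \<le> r"
      using kr[of x] x Lpos[of x] by (simp add: pos_divide_le_eq)
    finally have "0 \<le> r" .
    \<comment> \<open>Between \<open>\<epsilon>\<close> and \<open>d\<close> the crude bound of \<open>k\<close> by \<open>K\<close> suffices.\<close>
    have "k y / L y \<le> max (r / 2 + 2 * M) (K / L \<epsilon>)" if "x \<le> y" "y < d" for y
    proof (cases "y < \<epsilon>")
      case True
      then have "k y \<le> (r / 2 + 2 * M) * L y"
        using x that \<open>0 \<le> r\<close> by (intro recur kr) auto
      then show ?thesis using Lpos[OF that] by (simp add: pos_divide_le_eq le_max_iff_disj)
    next
      case False
      then have "k y / L y \<le> K / L \<epsilon>"
        using that b d x0 x Lpos \<epsilon> by (intro frac_le L_mono L_pos) auto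
      then show ?thesis by simp
    qed
    then have "r \<le> max (r / 2 + 2 * M) (K / L \<epsilon>)"
      unfolding r_def using x by (intro cSup_least) (auto simp: ratios_def)
    then have "r \<le> R" by (auto simp: R_def)
    then show "k x \<le> R * L x"
      using kr[of x] x by (intro order_trans[OF _ mult_right_mono[of r R]]) auto
  qed (use d in auto)
qed

text \<open>
  After division by \<open>L x\<close> the equation expresses \<open>(1 - c x) k(x) / L(x)\<close> as the integral of \<open>f x\<close>, the
  part with \<open>y \<ge> x / x0\<close>, plus a part near the diagonal that is at most a multiple of \<open>x\<close>. The functions
  \<open>f x\<close> have the common integrable majorant \<open>g\<close> and converge pointwise, so that the integrability of
  the limit comes with the convergence.
\<close>

theorem density_regular:
  "integrable lborel (\<lambda>y. k y * y powr - \<alpha>)"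
  "((\<lambda>x. k x / L x) \<longlongrightarrow> (LINT y|lborel. k y * y powr - \<alpha>)) (at_right 0)"
proof -
  obtain x0 A1 A2 where const: "comparison_constants x0 A1 A2"
    using comparison_constants_exist by blast
  note x0 = comparison_constantsD(1,2)[OF const] and A = comparison_constantsD(3,4)[OF const]
    and L1 = comparison_constantsD(5)[OF const] and L3 = comparison_constantsD(7)[OF const]
  obtain d R where d: "0 < d" "d \<le> x0" "c * d \<le> 1 / 2" and R: "0 \<le> R"
    and kR: "\<And>x. 0 < x \<Longrightarrow> x < d \<Longrightarrow> k x \<le> R * L x"
    by (rule density_le_L[OF const]) blast
  define \<epsilon> where "\<epsilon> = x0 * d"
  have \<epsilon>: "0 < \<epsilon>" "\<epsilon> < d"
    using x0 d by (auto simp: \<epsilon>_def)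
  define M where "M = A2 * (1 / d) powr (\<alpha> + 1 / 4)"
  define f where "f x y = jump_kernel \<nu> x y / L x * k y * indicator {x / x0..} y" for x y
  define g where "g y = R * A1 * (y powr - (1 / 2) * indicator {0..d} y) + M * k y" for y
  have [measurable]: "f x \<in> borel_measurable borel" for x
    unfolding f_def by measurable
  have Lpos: "0 < L x" if "0 < x" "x < \<epsilon>" for x
    using that \<epsilon> d x0 by (intro L_pos) auto
  have kint: "integrable lborel k"
    by (rule integrableI_nonneg) (auto simp: density_total)
  have "(\<lambda>y::real. y powr - (1 / 2)) integrable_on {0..d}"
    using d by (intro integrable_on_powr_from_0) auto
  then have "(\<lambda>y::real. y powr - (1 / 2)) absolutely_integrable_on {0..d}"
    by (intro nonnegative_absolutely_integrable_1) auto
  then have "integrable lborel (\<lambda>y::real. y powr - (1 / 2) * indicator {0..d} y)"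
    by (simp add: set_integrable_def integrable_completion mult.commute)
  then have gint: "integrable lborel g"
    unfolding g_def using kint by (intro Bochner_Integration.integrable_add integrable_mult_right)
  have f_nonneg: "0 \<le> f x y" for x y
    by (simp add: f_def)
  have dom: "f x y \<le> g y" if x: "0 < x" "x < \<epsilon>" for x y
  proof (cases "x / x0 \<le> y")
    case True
    then have xy: "x \<le> x0 * y" using x0 by (simp add: field_simps)
    have y: "0 < y" using True x x0 by (meson divide_pos_pos less_le_trans)
    show ?thesis
    proof (cases "y < d")
      case yd: True
      have "jump_kernel \<nu> x y * k y \<le> jump_kernel \<nu> x y * (R * L y)"
        using kR[OF y yd] by (intro mult_left_mono) auto
      also have "\<dots> = R * (jump_kernel \<nu> x y * L y)" by simp
      also have "\<dots> \<le> R * (A1 * y powr - (1 / 2) * L x)"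
        using xy x d yd R by (intro mult_left_mono L1) auto
      finally have "f x y \<le> R * A1 * y powr - (1 / 2)"
        using Lpos[OF x] True by (simp add: f_def field_simps)
      then show ?thesis
        using yd y A by (simp add: g_def M_def add_increasing2)
    next
      case False
      have "x < d" using x \<epsilon> by simp
      then have "jump_kernel \<nu> x y \<le> jump_kernel \<nu> x d"
        using False by (intro jump_kernel_mono_right levy) auto
      also have "\<dots> \<le> M * L x"
        unfolding M_def using x d x0 by (intro L3) (auto simp: \<epsilon>_def)
      finally have "jump_kernel \<nu> x y / L x \<le> M"
        using Lpos[OF x] by (simp add: field_simps)
      then have "jump_kernel \<nu> x y / L x * k y \<le> M * k y"
        by (rule mult_right_mono) simp
      then have "f x y \<le> M * k y"
        using True by (simp add: f_def)
      then show ?thesis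
        using A R by (auto simp: g_def intro!: add_increasing split: split_indicator)
    qed
  next
    case False
    then show ?thesis
      using A R by (auto simp: f_def g_def M_def split: split_indicator)
  qed
  have lim: "((\<lambda>x. f x y) \<longlongrightarrow> k y * y powr - \<alpha>) (at_right 0)" for y
  proof (cases "0 < y")
    case True
    have "((\<lambda>x. k y * (jump_kernel \<nu> x y / L x)) \<longlongrightarrow> k y * y powr - \<alpha>) (at_right 0)"
      by (intro tendsto_mult_left jump_kernel_ratio True)
    moreover have "eventually (\<lambda>x. x \<in> {0<..<x0 * y}) (at_right 0)"
      using True x0 by (intro eventually_at_right_real) auto
    then have "eventually (\<lambda>x. k y * (jump_kernel \<nu> x y / L x) = f x y) (at_right 0)"
      by eventually_elim (use x0 in \<open>auto simp: f_def field_simps\<close>)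
    ultimately show ?thesis
      by (rule Lim_transform_eventually)
  qed (simp add: f_def density_zero)
  have bounds: "(LINT y|lborel. f x y) \<le> (1 - c * x) * (k x / L x) \<and>
      (1 - c * x) * (k x / L x) \<le> (LINT y|lborel. f x y) + R * A2 * (x / x0 * jump_exponent \<nu>)"
    if x: "0 < x" "x < \<epsilon>" for x
  proof -
    have "c * x \<le> c * d" using x \<epsilon> drift_nonneg by (intro mult_left_mono) auto
    then have cx: "c * x \<le> 1 / 2" using d by simp
    have xe: "x / x0 \<le> d" using x x0 by (simp add: \<epsilon>_def field_simps)
    have fint: "integrable lborel (f x)"
      by (rule Bochner_Integration.integrable_bound[OF gint]) (auto simp: f_nonneg order_trans[OF dom[OF x] abs_ge_self])
    have "(\<integral>\<^sup>+ y. ennreal (jump_kernel \<nu> x y * k y) \<partial>lborel) =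
        (\<integral>\<^sup>+ y. ennreal (jump_kernel \<nu> x y * k y) * indicator {..<x / x0} y +
          ennreal (L x) * ennreal (f x y) \<partial>lborel)"
      using Lpos[OF x] by (intro nn_integral_cong)
        (auto simp: f_def split: split_indicator simp flip: ennreal_mult)
    also have "\<dots> = (\<integral>\<^sup>+ y \<in> {..<x / x0}. ennreal (jump_kernel \<nu> x y * k y) \<partial>lborel) +
        ennreal (L x) * ennreal (LINT y|lborel. f x y)"
      using fint f_nonneg by (simp add: nn_integral_add nn_integral_cmult nn_integral_eq_integral)
    finally have eq: "ennreal ((1 - c * x) * k x) =
        (\<integral>\<^sup>+ y \<in> {..<x / x0}. ennreal (jump_kernel \<nu> x y * k y) \<partial>lborel) +
        ennreal (L x * (LINT y|lborel. f x y))"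
      using equation[of x] x cx by (simp add: ennreal_mult Bochner_Integration.integral_nonneg f_nonneg)
    have "ennreal (L x * (LINT y|lborel. f x y)) \<le> ennreal ((1 - c * x) * k x)"
      unfolding eq by (rule add_increasing) auto
    then have lower: "L x * (LINT y|lborel. f x y) \<le> (1 - c * x) * k x"
      using cx by (subst (asm) ennreal_le_iff) auto
    have "(\<integral>\<^sup>+ y \<in> {..<x / x0}. ennreal (jump_kernel \<nu> x y * k y) \<partial>lborel) \<le>
        ennreal (R * A2 * (x / x0 * jump_exponent \<nu>) * L x)"
      by (rule nn_integral_jump_kernel_near[OF const, of R d x "x / x0"])
        (use x0 A R d x xe kR in auto)
    then have "ennreal ((1 - c * x) * k x) \<le> ennreal (R * A2 * (x / x0 * jump_exponent \<nu>) * L x) +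
        ennreal (L x * (LINT y|lborel. f x y))"
      unfolding eq by (rule add_right_mono)
    also have "\<dots> = ennreal (R * A2 * (x / x0 * jump_exponent \<nu>) * L x + L x * (LINT y|lborel. f x y))"
      using R A x x0 by (intro ennreal_plus[symmetric]) (auto simp: Bochner_Integration.integral_nonneg f_nonneg)
    finally have upper: "(1 - c * x) * k x \<le> R * A2 * (x / x0 * jump_exponent \<nu>) * L x + L x * (LINT y|lborel. f x y)"
      using R A x x0 by (subst (asm) ennreal_le_iff) (auto simp: Bochner_Integration.integral_nonneg f_nonneg)
    show ?thesis
      using lower upper Lpos[OF x] by (auto simp: pos_le_divide_eq pos_divide_le_eq algebra_simps)
  qed
  have seq: "integrable lborel (\<lambda>y. k y * y powr - \<alpha>)"
    "(\<lambda>n. LINT y|lborel. f (X n) y) \<longlonglongrightarrow> (LINT y|lborel. k y * y powr - \<alpha>)"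
    if X: "\<And>n. 0 < X n" "\<And>n. X n < \<epsilon>" "X \<longlonglongrightarrow> 0" for X
  proof -
    have "filterlim X (at_right 0) sequentially"
      using X by (auto simp: filterlim_at less_imp_neq[symmetric] intro!: always_eventually)
    then have l: "AE y in lborel. (\<lambda>n. f (X n) y) \<longlonglongrightarrow> k y * y powr - \<alpha>"
      using filterlim_compose[OF lim] by auto
    have b: "AE y in lborel. norm (f (X n) y) \<le> g y" for n
      using dom[OF X(1,2)] f_nonneg by simp
    show "integrable lborel (\<lambda>y. k y * y powr - \<alpha>)"
      by (rule integrable_dominated_convergence[OF _ _ gint l b]) auto
    show "(\<lambda>n. LINT y|lborel. f (X n) y) \<longlonglongrightarrow> (LINT y|lborel. k y * y powr - \<alpha>)"
      by (rule integral_dominated_convergence[OF _ _ gint l b]) auto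
  qed
  \<comment> \<open>Integrability of the limit follows along any one sequence tending to \<open>0\<close>.\<close>
  have "(\<lambda>n. \<epsilon> / real (n + 2)) \<longlonglongrightarrow> 0"
    by real_asymp
  then show "integrable lborel (\<lambda>y. k y * y powr - \<alpha>)"
    using \<epsilon> by (intro seq(1)[of "\<lambda>n. \<epsilon> / real (n + 2)"])
      (auto simp: field_simps intro: add_pos_nonneg)
  have F: "((\<lambda>x. LINT y|lborel. f x y) \<longlongrightarrow> (LINT y|lborel. k y * y powr - \<alpha>)) (at_right 0)"
    using \<epsilon>(1) by (intro tendsto_at_right_sequentially[of 0 \<epsilon>] seq(2)) auto
  have near: "eventually (\<lambda>x. x \<in> {0<..<\<epsilon>}) (at_right 0)"
    using \<epsilon> by (intro eventually_at_right_real) auto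
  have "((\<lambda>x. (1 - c * x) * (k x / L x)) \<longlongrightarrow> (LINT y|lborel. k y * y powr - \<alpha>)) (at_right 0)"
  proof (rule tendsto_sandwich[OF _ _ F])
    show "((\<lambda>x. (LINT y|lborel. f x y) + R * A2 * (x / x0 * jump_exponent \<nu>)) \<longlongrightarrow>
        (LINT y|lborel. k y * y powr - \<alpha>)) (at_right 0)"
      using x0 by (auto intro!: tendsto_eq_intros F)
    show "eventually (\<lambda>x. (LINT y|lborel. f x y) \<le> (1 - c * x) * (k x / L x)) (at_right 0)"
      using near by eventually_elim (use bounds in auto)
    show "eventually (\<lambda>x. (1 - c * x) * (k x / L x) \<le>
        (LINT y|lborel. f x y) + R * A2 * (x / x0 * jump_exponent \<nu>)) (at_right 0)"
      using near by eventually_elim (use bounds in auto)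
  qed
  then have "((\<lambda>x. (1 - c * x) * (k x / L x) / (1 - c * x)) \<longlongrightarrow>
      (LINT y|lborel. k y * y powr - \<alpha>) / (1 - c * 0)) (at_right 0)"
    by (rule tendsto_divide) (auto intro!: tendsto_eq_intros)
  moreover have "eventually (\<lambda>x. (1 - c * x) * (k x / L x) / (1 - c * x) = k x / L x) (at_right 0)"
    using near
  proof eventually_elim
    case (elim x)
    then have "c * x \<le> c * d" using \<epsilon> drift_nonneg by (intro mult_left_mono) auto
    then show ?case using d by simp
  qed
  ultimately show "((\<lambda>x. k x / L x) \<longlongrightarrow> (LINT y|lborel. k y * y powr - \<alpha>)) (at_right 0)"
    by (simp add: Lim_transform_eventually)
qed

text \<open>
  The density lives on the positive half-line, where the power is positive, and has mass \<open>1\<close>.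
\<close>

lemma density_moment_pos: "0 < (LINT y|lborel. k y * y powr - \<alpha>)"
proof -
  have "0 \<le> (LINT y|lborel. k y * y powr - \<alpha>)"
    by (intro Bochner_Integration.integral_nonneg) auto
  moreover have "(LINT y|lborel. k y * y powr - \<alpha>) \<noteq> 0"
  proof
    assume "(LINT y|lborel. k y * y powr - \<alpha>) = 0"
    then have "AE y in lborel. k y * y powr - \<alpha> = 0"
      using density_regular(1) by (subst (asm) integral_nonneg_eq_0_iff_AE) auto
    then have "AE y in lborel. ennreal (k y) = 0"
      by eventually_elim (metis density_zero ennreal_0 less_irrefl linorder_le_less_linear
          mult_eq_0_iff powr_gt_zero)
    then have "(\<integral>\<^sup>+ y. ennreal (k y) \<partial>lborel) = (\<integral>\<^sup>+ y. 0 \<partial>(lborel :: real measure))"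
      by (rule nn_integral_cong_AE)
    then show False by (simp add: density_total)
  qed
  ultimately show ?thesis by linarith
qed

end

section \<open>The exponential functional\<close>

lemma density_equationI:
  assumes "prob_space M" and chars: "has_characteristics M \<zeta> c \<nu>" and "0 \<le> q"
    and dens: "exp_functional_density M \<zeta> e c \<nu> q k"
  shows "density_equation \<nu> c q k"
proof
  interpret prob_space M by fact
  show "subordinator_levy_measure \<nu>" and c: "0 \<le> c"
    using chars by (auto simp: has_characteristics_def)
  show "0 \<le> q" by fact
  show "k \<in> borel_measurable borel" and nonneg: "\<And>x. 0 \<le> k x"
    using dens by (auto simp: exp_functional_density_def)
  show "k x = 0" if "x \<le> 0" for x
    using dens that by (auto simp: exp_functional_density_def density_range_def)
  have D: "distributed M lborel (exp_functional \<zeta> e) (\<lambda>x. ennreal (k x))"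
    using dens by (auto simp: exp_functional_density_def)
  show "(\<integral>\<^sup>+ y. ennreal (k y) \<partial>lborel) = 1"
    using distributed_nn_integral[OF D, of "\<lambda>_. 1"] by (simp add: emeasure_space_1)
  fix x assume x: "0 < x" "c * x < 1"
  then have "x \<in> density_range c"
    using c by (cases "c = 0") (auto simp: density_range_def field_simps)
  then have "ennreal ((1 - c * x) * k x) =
      (\<integral>\<^sup>+ y \<in> {x<..}. ennreal (tail \<nu> (ln (y / x)) * k y) \<partial>lborel)
      + ennreal q * (\<integral>\<^sup>+ y \<in> {x<..}. ennreal (k y) \<partial>lborel)"
    using dens by (auto simp: exp_functional_density_def)
  also have "(\<integral>\<^sup>+ y \<in> {x<..}. ennreal (tail \<nu> (ln (y / x)) * k y) \<partial>lborel) =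
      (\<integral>\<^sup>+ y. ennreal (jump_kernel \<nu> x y * k y) \<partial>lborel)"
    using x by (intro nn_integral_cong) (auto simp: jump_kernel_def split: split_indicator)
  finally show "ennreal ((1 - c * x) * k x) =
      (\<integral>\<^sup>+ y. ennreal (jump_kernel \<nu> x y * k y) \<partial>lborel)
      + ennreal q * (\<integral>\<^sup>+ y \<in> {x<..}. ennreal (k y) \<partial>lborel)" .
qed

theorem theorem2p6:
  fixes M :: "'a measure" and \<zeta> :: "real \<Rightarrow> 'a \<Rightarrow> real" and e :: "'a \<Rightarrow> ereal"
    and c q \<alpha> :: real and \<nu> :: "real measure" and k :: "real \<Rightarrow> real"
  assumes "0 \<le> q"
    and "subordinator M \<zeta>"
    and "has_characteristics M \<zeta> c \<nu>"
    and "q = 0 \<Longrightarrow> 0 \<le> \<alpha>"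
    and "q = 0 \<Longrightarrow>
          (\<forall>y. ((\<lambda>x. tail \<nu> (x + y) / tail \<nu> x) \<longlongrightarrow> exp (- \<alpha> * y)) at_top)"
    and "exponential_time M q e"
    and "indep_of_process M e \<zeta>"
    and "exp_functional_density M \<zeta> e c \<nu> q k"
  shows "(0 < q \<longrightarrow> (k \<longlongrightarrow> q) (at_right 0)) \<and>
         (q = 0 \<longrightarrow>
            integrable M (\<lambda>\<omega>. exp_functional \<zeta> e \<omega> powr (- \<alpha>)) \<and>
            ((\<lambda>x. k x / (prob_space.expectation M (\<lambda>\<omega>. exp_functional \<zeta> e \<omega> powr (- \<alpha>))
                           * tail \<nu> (ln (1 / x)))) \<longlongrightarrow> 1) (at_right 0))"
proof (intro conjI impI)
  have "prob_space M"
    using assms(2) by (simp add: subordinator_def levy_process_def)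
  then interpret density_equation \<nu> c q k
    using assms by (intro density_equationI)
  show "(k \<longlongrightarrow> q) (at_right 0)"
    by (rule density_tendsto_rate)
next
  have "prob_space M"
    using assms(2) by (simp add: subordinator_def levy_process_def)
  assume q: "q = 0"
  then interpret density_equation \<nu> c 0 k
    using \<open>prob_space M\<close> assms by (intro density_equationI) auto
  interpret regular_density_equation \<nu> c k \<alpha>
    using assms(4,5) q by unfold_locales auto
  have D: "distributed M lborel (exp_functional \<zeta> e) (\<lambda>x. ennreal (k x))"
    using assms(8) by (auto simp: exp_functional_density_def)
  have E: "(LINT y|lborel. k y * y powr - \<alpha>) =
      prob_space.expectation M (\<lambda>\<omega>. exp_functional \<zeta> e \<omega> powr - \<alpha>)"
    by (rule distributed_integral[OF D]) auto
  show "integrable M (\<lambda>\<omega>. exp_functional \<zeta> e \<omega> powr - \<alpha>)"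
    using density_regular(1) by (subst distributed_integrable[OF D, symmetric]) auto
  have "((\<lambda>x. k x / jump_kernel \<nu> x 1 / (LINT y|lborel. k y * y powr - \<alpha>)) \<longlongrightarrow>
      (LINT y|lborel. k y * y powr - \<alpha>) / (LINT y|lborel. k y * y powr - \<alpha>)) (at_right 0)"
    by (intro tendsto_divide density_regular(2) tendsto_const) (use density_moment_pos in linarith)
  then have "((\<lambda>x. k x / jump_kernel \<nu> x 1 / (LINT y|lborel. k y * y powr - \<alpha>)) \<longlongrightarrow> 1) (at_right 0)"
    by (subst (asm) divide_self) (use density_moment_pos in linarith)
  moreover have "eventually (\<lambda>x::real. x \<in> {0<..<1}) (at_right 0)"
    by (intro eventually_at_right_real) auto
  then have "eventually (\<lambda>x. k x / jump_kernel \<nu> x 1 / (LINT y|lborel. k y * y powr - \<alpha>) =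
      k x / (prob_space.expectation M (\<lambda>\<omega>. exp_functional \<zeta> e \<omega> powr - \<alpha>) * tail \<nu> (ln (1 / x))))
      (at_right 0)"
    unfolding E by eventually_elim (simp add: jump_kernel_def mult.commute)
  ultimately show "((\<lambda>x. k x / (prob_space.expectation M (\<lambda>\<omega>. exp_functional \<zeta> e \<omega> powr (- \<alpha>))
      * tail \<nu> (ln (1 / x)))) \<longlongrightarrow> 1) (at_right 0)"
    by (rule Lim_transform_eventually)
qed

end
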